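(* Let $G=SU(2)\times U(1)$, let $P\to M$ be a principal $G$-bundle, let $A$ be a connection on $P$ and let $\varphi$ be a nowhere vanishing section of $F=P\times_G\mathbb C^2$. Then the common stabilizer $\mathcal{G}au_{A,\varphi}$ of $(A,\varphi)$ is either $K$, if $\beta(p)=0$ for all $p\in P_A$ and the stabilizer of $A$ is $SU(2)\times U(1)$ or $U(1)\times U(1)$; or otherwise it is $\mathbb Z_2$.
   Context: $M$ is a compact connected oriented $3$-manifold. $G$ acts on $\mathbb C^2$ by $\rho_{a,\vartheta}(z)=a\,e^{\frac i2\vartheta}z$ for $a\in SU(2)$, $\vartheta\in[0,4\pi)$, where $\vartheta$ parametrizes $U(1)$ as in the definition of $K$ below. Let $$K=\Bigl\{\Bigl(\begin{pmatrix}e^{\frac i2\vartheta}&0\\0&e^{-\frac i2\vartheta}\end{pmatrix},e^{i\vartheta}\Bigr):\vartheta\in[0,4\pi)\Bigr\}\simeq U(1),$$ which is the stabilizer of the points $\frac{r}{\sqrt2}(0,v)$, $r>0$ ($v\ne0$ a fixed real number); all non-zero points of $\mathbb C^2$ have stabilizers conjugate to $K$, and $\mathbb Z_2=\{(\mathbb 1,1),(-\mathbb 1,1)\}\subset K$. Viewing $\varphi$ as a $G$-equivariant map $P\to\mathbb C^2\setminus\{0\}$, write uniquely $\varphi(p)=\frac{\eta}{\sqrt2}\,\phi(p)\cdot\binom0v$ with $\eta\colon M\to\mathbb R_{>0}$ smooth and $\phi\colon P\to G/K$ smooth and $G$-equivariant. Write the $SU(2)$-component of a representative of $\phi(p)$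 as $\begin{pmatrix}\alpha&-\bar\beta\\\beta&\bar\alpha\end{pmatrix}$ with $|\alpha|^2+|\beta|^2=1$; the condition $\beta(p)=0$ does not depend on the representative. $\mathcal{G}au$ is the group of gauge transformations, i.e. smooth maps $\lambda\colon P\to G$ with $\lambda(p\cdot g)=g^{-1}\lambda(p)g$, acting on connections and sections in the usual way: $A\mapsto\mathrm{Ad}_\lambda A+\lambda\,d\lambda^{-1}$, $\varphi\mapsto\lambda\cdot\varphi$. Fix a base point $p_0\in P$ with $\phi(p_0)=[e]$; $P_A$ is the holonomy bundle of $A$ through $p_0$ (all points joined to $p_0$ by $A$-horizontal paths). Stabilizers of $A$ and of $(A,\varphi)$ are identified with subgroups of $G$ through the injective evaluation $\lambda\mapsto\lambda(p_0)$ (so the stabilizer of $A$ is the centralizer $C_G(\mathrm{Hol}_A)$ of the holonomy group based at $p_0$). $U(1)\times U(1)$ denotes the subgroup whose first factor is the diagonal torus $\alpha\mapsto\mathrm{diag}(\alpha,\bar\alpha)$ of $SU(2)$.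
   Formalization: The U(1)-element with parameter ϑ∈[0,4π) is taken as e^{iϑ/2}, not e^{iϑ}, since otherwise the action a·e^{iϑ/2}z is not well defined on SU(2)×U(1); so K consists of (diag(w,w̄),w) with |w|=1, and Z_2={(1,1),(-1,-1)} in place of {(1,1),(-1,1)}. *)

theory Defs
  imports "HOL-Analysis.Analysis"
begin

section \<open>Smooth maps between subsets of Euclidean spaces\<close>

text \<open>
  \<open>C_on k S f\<close>: \<open>f\<close> is of class \<open>C\<^sup>k\<close> on the open set \<open>S\<close>.
\<close>

fun C_on :: "nat \<Rightarrow> 'a::euclidean_space set \<Rightarrow> ('a \<Rightarrow> 'b::euclidean_space) \<Rightarrow> bool" where
  "C_on 0 S f \<longleftrightarrow> continuous_on S f"
| "C_on (Suc k) S f \<longleftrightarrow>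
     (\<forall>x\<in>S. f differentiable (at x)) \<and> (\<forall>u. C_on k S (\<lambda>x. frechet_derivative f (at x) u))"

text \<open>
  A map on an arbitrary subset of a Euclidean space is smooth if it locally extends to a smooth
  map on an open set.  For open sets this is ordinary smoothness; for an embedded submanifold
  such as the group \<open>G\<close> below it is smoothness with respect to the submanifold structure.
\<close>

definition smooth_on :: "'a::euclidean_space set \<Rightarrow> ('a \<Rightarrow> 'b::euclidean_space) \<Rightarrow> bool" where
  "smooth_on S f \<longleftrightarrow>
     (\<forall>x\<in>S. \<exists>W F. open W \<and> x \<in> W \<and> (\<forall>k. C_on k W F) \<and> (\<forall>y\<in>W \<inter> S. F y = f y))"


section \<open>Smooth manifolds\<close>

text \<open>
  A manifold without boundary is a second countable Hausdorff space (the whole type) together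
  with a smooth atlas; a chart is a pair of its domain and its coordinate map.
\<close>

type_synonym ('m, 'e) chart = "'m set \<times> ('m \<Rightarrow> 'e)"

definition dom :: "('m, 'e) chart \<Rightarrow> 'm set" where
  "dom c = fst c"

definition coord :: "('m, 'e) chart \<Rightarrow> 'm \<Rightarrow> 'e" where
  "coord c = snd c"

definition coord_inv :: "('m, 'e) chart \<Rightarrow> 'e \<Rightarrow> 'm" where
  "coord_inv c = inv_into (dom c) (coord c)"

definition transition :: "('m, 'e) chart \<Rightarrow> ('m, 'e) chart \<Rightarrow> 'e \<Rightarrow> 'e" where
  "transition c c' = coord c' \<circ> coord_inv c"

definition is_chart :: "('m::topological_space, 'e::euclidean_space) chart \<Rightarrow> bool" where
  "is_chart c \<longleftrightarrow> open (dom c) \<and> open (coord c ` dom c) \<and>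
     homeomorphism (dom c) (coord c ` dom c) (coord c) (coord_inv c)"

definition smooth_atlas ::
  "('m::{t2_space,second_countable_topology}, 'e::euclidean_space) chart set \<Rightarrow> bool" where
  "smooth_atlas M \<longleftrightarrow>
     (\<forall>c\<in>M. is_chart c) \<and> (\<Union>c\<in>M. dom c) = UNIV \<and>
     (\<forall>c\<in>M. \<forall>c'\<in>M. smooth_on (coord c ` (dom c \<inter> dom c')) (transition c c'))"

definition oriented_atlas ::
  "('m::{t2_space,second_countable_topology}, real ^ 'n) chart set \<Rightarrow> bool" where
  "oriented_atlas M \<longleftrightarrow> smooth_atlas M \<and>
     (\<forall>c\<in>M. \<forall>c'\<in>M. \<forall>x \<in> coord c ` (dom c \<inter> dom c').
        det (matrix (frechet_derivative (transition c c') (at x))) > 0)"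

text \<open>
  Smoothness of a vector-valued function on an open subset \<open>D\<close> of \<open>M\<close>, of a map from \<open>M\<close> to a
  manifold \<open>N\<close>, and of a map \<open>D \<times> S \<rightarrow> N\<close>, where \<open>S\<close> is a submanifold of a Euclidean space.
\<close>

definition smooth_fun ::
  "('m, 'e::euclidean_space) chart set \<Rightarrow> 'm set \<Rightarrow> ('m \<Rightarrow> 'b::euclidean_space) \<Rightarrow> bool" where
  "smooth_fun M D F \<longleftrightarrow> (\<forall>c\<in>M. smooth_on (coord c ` (dom c \<inter> D)) (F \<circ> coord_inv c))"

definition smooth_map ::
  "('m::topological_space, 'e::euclidean_space) chart set \<Rightarrow>
   ('n::topological_space, 'f::euclidean_space) chart set \<Rightarrow> ('m \<Rightarrow> 'n) \<Rightarrow> bool" where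
  "smooth_map M N F \<longleftrightarrow> continuous_on UNIV F \<and>
     (\<forall>c\<in>M. \<forall>d\<in>N. smooth_on (coord c ` (dom c \<inter> F -` dom d)) (coord d \<circ> F \<circ> coord_inv c))"

definition smooth_map2 ::
  "('m::topological_space, 'e::euclidean_space) chart set \<Rightarrow> 'm set \<Rightarrow> 's::euclidean_space set \<Rightarrow>
   ('n::topological_space, 'f::euclidean_space) chart set \<Rightarrow> ('m \<Rightarrow> 's \<Rightarrow> 'n) \<Rightarrow> bool" where
  "smooth_map2 M D S N F \<longleftrightarrow> continuous_on (D \<times> S) (\<lambda>(x, s). F x s) \<and>
     (\<forall>c\<in>M. \<forall>d\<in>N.
        smooth_on {(coord c x, s) | x s. x \<in> dom c \<inter> D \<and> s \<in> S \<and> F x s \<in> dom d}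
                  (\<lambda>(y, s). coord d (F (coord_inv c y) s)))"

text \<open>
  A tangent vector at \<open>p\<close> is given by its components in all charts around \<open>p\<close>, which transform
  with the Jacobians of the transition maps.  (Components in all other charts are set to \<open>0\<close>.)
\<close>

type_synonym ('m, 'e) tangent = "('m, 'e) chart \<Rightarrow> 'e"

definition tangent_space ::
  "('m, 'e::euclidean_space) chart set \<Rightarrow> 'm \<Rightarrow> ('m, 'e) tangent set" where
  "tangent_space M p =
     {X. (\<forall>c\<in>M. \<forall>c'\<in>M. p \<in> dom c \<inter> dom c' \<longrightarrow>
             X c' = frechet_derivative (transition c c') (at (coord c p)) (X c)) \<and>
         (\<forall>c. c \<notin> M \<or> p \<notin> dom c \<longrightarrow> X c = 0)}"

definition chart_at :: "('m, 'e) chart set \<Rightarrow> 'm \<Rightarrow> ('m, 'e) chart" where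
  "chart_at M p = (SOME c. c \<in> M \<and> p \<in> dom c)"

definition coord_vector ::
  "('m, 'e::euclidean_space) chart set \<Rightarrow> ('m, 'e) chart \<Rightarrow> 'e \<Rightarrow> 'm \<Rightarrow> ('m, 'e) tangent" where
  "coord_vector M c u p =
     (\<lambda>c'. if c' \<in> M \<and> p \<in> dom c'
           then frechet_derivative (transition c c') (at (coord c p)) u else 0)"

definition differential ::
  "('m, 'e::euclidean_space) chart set \<Rightarrow> ('m \<Rightarrow> 'b::euclidean_space) \<Rightarrow>
   'm \<Rightarrow> ('m, 'e) tangent \<Rightarrow> 'b" where
  "differential M F p X =
     (let c = chart_at M p in frechet_derivative (F \<circ> coord_inv c) (at (coord c p)) (X c))"

definition pushforward ::
  "('m, 'e::euclidean_space) chart set \<Rightarrow> ('m \<Rightarrow> 'm) \<Rightarrow>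
   'm \<Rightarrow> ('m, 'e) tangent \<Rightarrow> ('m, 'e) tangent" where
  "pushforward M F p X =
     (\<lambda>d. if d \<in> M \<and> F p \<in> dom d then differential M (coord d \<circ> F) p X else 0)"

definition velocity ::
  "('m, 'e::euclidean_space) chart set \<Rightarrow> real set \<Rightarrow> (real \<Rightarrow> 'm) \<Rightarrow> real \<Rightarrow> ('m, 'e) tangent" where
  "velocity M T \<gamma> t =
     (\<lambda>c. if c \<in> M \<and> \<gamma> t \<in> dom c then vector_derivative (coord c \<circ> \<gamma>) (at t within T) else 0)"

definition C1_curve ::
  "('m::topological_space, 'e::euclidean_space) chart set \<Rightarrow> (real \<Rightarrow> 'm) \<Rightarrow> bool" where
  "C1_curve M \<gamma> \<longleftrightarrow> continuous_on {0..1} \<gamma> \<and>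
     (\<forall>c\<in>M. let T = {0..1} \<inter> \<gamma> -` dom c in
        (\<forall>t\<in>T. (coord c \<circ> \<gamma>) differentiable (at t within {0..1})) \<and>
        continuous_on T (\<lambda>t. vector_derivative (coord c \<circ> \<gamma>) (at t within {0..1})))"


section \<open>The group \<open>G = SU(2) \<times> U(1)\<close> and its representation\<close>

text \<open>
  \<open>G\<close> and its Lie algebra are embedded in \<open>\<complex>\<^sup>2\<^sup>\<times>\<^sup>2 \<times> \<complex>\<close>.  The factor \<open>U(1)\<close> is parametrized
  bijectively by \<open>\<theta> \<in> [0, 4 \<pi>)\<close>, that is, the group element with parameter \<open>\<theta>\<close> is realized as the
  unit complex number \<open>e\<^sup>i\<^sup>\<theta>\<^sup>/\<^sup>2\<close>; with \<open>e\<^sup>i\<^sup>\<theta>\<close> instead, the action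
  \<open>(a, \<theta>) \<cdot> w = e\<^sup>i\<^sup>\<theta>\<^sup>/\<^sup>2 a w\<close> would not be well defined on the group.  In particular
  the element with parameter \<open>2 \<pi>\<close> is \<open>-1\<close>.
\<close>

type_synonym amb = "(complex ^ 2 ^ 2) \<times> complex"

definition adjoint_mat :: "complex ^ 2 ^ 2 \<Rightarrow> complex ^ 2 ^ 2" where
  "adjoint_mat a = (\<chi> i j. cnj (a $ j $ i))"

definition diag2 :: "complex \<Rightarrow> complex \<Rightarrow> complex ^ 2 ^ 2" where
  "diag2 x y = (\<chi> i j. if i = j then (if i = 1 then x else y) else 0)"

definition SU2 :: "(complex ^ 2 ^ 2) set" where
  "SU2 = {a. adjoint_mat a ** a = mat 1 \<and> det a = 1}"

definition u1 :: "real \<Rightarrow> complex" where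
  "u1 \<theta> = cis (\<theta> / 2)"

definition U1 :: "complex set" where
  "U1 = u1 ` {0..<4 * pi}"

definition G :: "amb set" where
  "G = SU2 \<times> U1"

definition gmul :: "amb \<Rightarrow> amb \<Rightarrow> amb" where
  "gmul g h = (fst g ** fst h, snd g * snd h)"

definition gone :: amb where
  "gone = (mat 1, 1)"

definition ginv :: "amb \<Rightarrow> amb" where
  "ginv g = (adjoint_mat (fst g), cnj (snd g))"

definition lie_G :: "amb set" where
  "lie_G = {(X, y). adjoint_mat X = - X \<and> trace X = 0 \<and> cnj y = - y}"

definition Ad :: "amb \<Rightarrow> amb \<Rightarrow> amb" where
  "Ad g \<xi> = gmul (gmul g \<xi>) (ginv g)"

definition rho :: "amb \<Rightarrow> complex ^ 2 \<Rightarrow> complex ^ 2" where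
  "rho g w = snd g *s (fst g *v w)"

definition K :: "amb set" where
  "K = {(diag2 (cis (\<theta> / 2)) (cis (- \<theta> / 2)), u1 \<theta>) | \<theta>. \<theta> \<in> {0..<4 * pi}}"

definition Z2 :: "amb set" where
  "Z2 = {(mat 1, u1 0), (- mat 1, u1 (2 * pi))}"

definition U1_U1 :: "amb set" where
  "U1_U1 = {diag2 \<alpha> (cnj \<alpha>) | \<alpha>. cmod \<alpha> = 1} \<times> U1"

definition coset_K :: "amb \<Rightarrow> amb set" where
  "coset_K g = gmul g ` K"


section \<open>Principal bundles, connections and gauge transformations\<close>

definition local_trivialization ::
  "('m::topological_space, 'e::euclidean_space) chart set \<Rightarrow>
   ('p::topological_space, 'f::euclidean_space) chart set \<Rightarrow>
   ('p \<Rightarrow> 'm) \<Rightarrow> ('p \<Rightarrow> amb \<Rightarrow> 'p) \<Rightarrow> 'm set \<Rightarrow> ('p \<Rightarrow> amb) \<Rightarrow> bool" where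
  "local_trivialization M P \<pi> act D h \<longleftrightarrow> open D \<and>
     smooth_fun P (\<pi> -` D) h \<and> h ` (\<pi> -` D) \<subseteq> G \<and>
     (\<forall>p\<in>\<pi> -` D. \<forall>g\<in>G. h (act p g) = gmul (h p) g) \<and>
     (\<exists>\<Psi>. smooth_map2 M D G P \<Psi> \<and>
        (\<forall>x\<in>D. \<forall>g\<in>G. \<pi> (\<Psi> x g) = x \<and> h (\<Psi> x g) = g) \<and>
        (\<forall>p\<in>\<pi> -` D. \<Psi> (\<pi> p) (h p) = p))"

text \<open>Freeness of the action and transitivity on the fibres follow from local triviality.\<close>

definition principal_bundle ::
  "('m::{t2_space,second_countable_topology}, 'e::euclidean_space) chart set \<Rightarrow>
   ('p::{t2_space,second_countable_topology}, 'f::euclidean_space) chart set \<Rightarrow>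
   ('p \<Rightarrow> 'm) \<Rightarrow> ('p \<Rightarrow> amb \<Rightarrow> 'p) \<Rightarrow> bool" where
  "principal_bundle M P \<pi> act \<longleftrightarrow>
     smooth_atlas M \<and> smooth_atlas P \<and> smooth_map P M \<pi> \<and>
     smooth_map2 P UNIV G P act \<and>
     (\<forall>p. act p gone = p) \<and>
     (\<forall>p. \<forall>g\<in>G. \<forall>h\<in>G. act p (gmul g h) = act (act p g) h) \<and>
     (\<forall>p. \<forall>g\<in>G. \<pi> (act p g) = \<pi> p) \<and>
     (\<forall>x. \<exists>D h. x \<in> D \<and> local_trivialization M P \<pi> act D h)"

text \<open>
  Connection forms.  The value at \<open>p\<close> of the fundamental vector field generated by \<open>\<xi>\<close> is the
  velocity of \<open>p \<cdot> h(t)\<close> for any curve \<open>h\<close> in \<open>G\<close> with \<open>h(0) = e\<close> and \<open>h'(0) = \<xi>\<close>.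
\<close>

definition connection_form ::
  "('p::topological_space, 'f::euclidean_space) chart set \<Rightarrow> ('p \<Rightarrow> amb \<Rightarrow> 'p) \<Rightarrow>
   ('p \<Rightarrow> ('p, 'f) tangent \<Rightarrow> amb) \<Rightarrow> bool" where
  "connection_form P act A \<longleftrightarrow>
     (\<forall>p. \<forall>X\<in>tangent_space P p. A p X \<in> lie_G) \<and>
     (\<forall>p. \<forall>X\<in>tangent_space P p. \<forall>Y\<in>tangent_space P p.
        A p (\<lambda>c. X c + Y c) = A p X + A p Y) \<and>
     (\<forall>p. \<forall>X\<in>tangent_space P p. \<forall>r. A p (\<lambda>c. r *\<^sub>R X c) = r *\<^sub>R A p X) \<and>
     (\<forall>c\<in>P. \<forall>u. smooth_fun P (dom c) (\<lambda>p. A p (coord_vector P c u p))) \<and>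
     (\<forall>p h \<xi>. range h \<subseteq> G \<and> h 0 = gone \<and> (h has_vector_derivative \<xi>) (at 0) \<longrightarrow>
        A p (velocity P UNIV (\<lambda>t. act p (h t)) 0) = \<xi>) \<and>
     (\<forall>p. \<forall>g\<in>G. \<forall>X\<in>tangent_space P p.
        A (act p g) (pushforward P (\<lambda>q. act q g) p X) = Ad (ginv g) (A p X))"

text \<open>
  A section of the associated bundle \<open>P \<times>\<^sub>G \<complex>\<^sup>2\<close>, viewed as an equivariant map on \<open>P\<close>.
\<close>

definition equivariant_section ::
  "('p, 'f::euclidean_space) chart set \<Rightarrow> ('p \<Rightarrow> amb \<Rightarrow> 'p) \<Rightarrow> ('p \<Rightarrow> complex ^ 2) \<Rightarrow> bool" where
  "equivariant_section P act \<Phi> \<longleftrightarrow> smooth_fun P UNIV \<Phi> \<and>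
     (\<forall>p. \<forall>g\<in>G. \<Phi> (act p g) = rho (ginv g) (\<Phi> p))"

definition Gau ::
  "('p, 'f::euclidean_space) chart set \<Rightarrow> ('p \<Rightarrow> amb \<Rightarrow> 'p) \<Rightarrow> ('p \<Rightarrow> amb) set" where
  "Gau P act = {l. smooth_fun P UNIV l \<and> range l \<subseteq> G \<and>
     (\<forall>p. \<forall>g\<in>G. l (act p g) = gmul (gmul (ginv g) (l p)) g)}"

definition gauge_connection ::
  "('p, 'f::euclidean_space) chart set \<Rightarrow> ('p \<Rightarrow> amb) \<Rightarrow>
   ('p \<Rightarrow> ('p, 'f) tangent \<Rightarrow> amb) \<Rightarrow> 'p \<Rightarrow> ('p, 'f) tangent \<Rightarrow> amb" where
  "gauge_connection P l A p X =
     Ad (l p) (A p X) + gmul (l p) (differential P (\<lambda>q. ginv (l q)) p X)"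

definition gauge_section ::
  "('p \<Rightarrow> amb) \<Rightarrow> ('p \<Rightarrow> complex ^ 2) \<Rightarrow> 'p \<Rightarrow> complex ^ 2" where
  "gauge_section l \<Phi> p = rho (l p) (\<Phi> p)"

definition Gau_A ::
  "('p, 'f::euclidean_space) chart set \<Rightarrow> ('p \<Rightarrow> amb \<Rightarrow> 'p) \<Rightarrow>
   ('p \<Rightarrow> ('p, 'f) tangent \<Rightarrow> amb) \<Rightarrow> ('p \<Rightarrow> amb) set" where
  "Gau_A P act A =
     {l \<in> Gau P act. \<forall>p. \<forall>X\<in>tangent_space P p. gauge_connection P l A p X = A p X}"

definition Gau_A_section ::
  "('p, 'f::euclidean_space) chart set \<Rightarrow> ('p \<Rightarrow> amb \<Rightarrow> 'p) \<Rightarrow>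
   ('p \<Rightarrow> ('p, 'f) tangent \<Rightarrow> amb) \<Rightarrow> ('p \<Rightarrow> complex ^ 2) \<Rightarrow> ('p \<Rightarrow> amb) set" where
  "Gau_A_section P act A \<Phi> = {l \<in> Gau_A P act A. gauge_section l \<Phi> = \<Phi>}"

text \<open>
  Stabilizers are identified with subgroups of \<open>G\<close> by evaluation at the base point, which is
  injective on them over a connected base.
\<close>

definition eval_at :: "'p \<Rightarrow> ('p \<Rightarrow> amb) set \<Rightarrow> amb set" where
  "eval_at p\<^sub>0 S = (\<lambda>l. l p\<^sub>0) ` S"

definition horizontal_curve ::
  "('p::topological_space, 'f::euclidean_space) chart set \<Rightarrow>
   ('p \<Rightarrow> ('p, 'f) tangent \<Rightarrow> amb) \<Rightarrow> (real \<Rightarrow> 'p) \<Rightarrow> bool" where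
  "horizontal_curve P A \<gamma> \<longleftrightarrow> C1_curve P \<gamma> \<and>
     (\<forall>t\<in>{0..1}. A (\<gamma> t) (velocity P {0..1} \<gamma> t) = 0)"

text \<open>Chains of horizontal \<open>C\<^sup>1\<close> curves are the piecewise \<open>C\<^sup>1\<close> horizontal paths.\<close>

definition holonomy_bundle ::
  "('p::topological_space, 'f::euclidean_space) chart set \<Rightarrow>
   ('p \<Rightarrow> ('p, 'f) tangent \<Rightarrow> amb) \<Rightarrow> 'p \<Rightarrow> 'p set" where
  "holonomy_bundle P A p\<^sub>0 =
     {p. (\<lambda>q r. \<exists>\<gamma>. horizontal_curve P A \<gamma> \<and> \<gamma> 0 = q \<and> \<gamma> 1 = r)\<^sup>*\<^sup>* p\<^sub>0 p}"


section \<open>The polar decomposition of a nowhere vanishing section\<close>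

text \<open>
  \<open>phi v \<Phi> p\<close> is the coset \<open>g K\<close> in \<open>\<Phi> p = (\<eta> / \<surd>2) g \<cdot> (0, v)\<close>, \<open>\<eta> > 0\<close>, as the
  set of its representatives; see \<open>polar_decomposition\<close> below.
\<close>

definition phi :: "real \<Rightarrow> ('p \<Rightarrow> complex ^ 2) \<Rightarrow> 'p \<Rightarrow> amb set" where
  "phi v \<Phi> p =
     {g \<in> G. \<exists>\<eta>>0. \<Phi> p = (\<eta> / sqrt 2) *\<^sub>R rho g (vector [0, complex_of_real v])}"

text \<open>
  For \<open>a = ((\<alpha>, - cnj \<beta>), (\<beta>, cnj \<alpha>))\<close> in \<open>SU(2)\<close>, \<open>\<beta>\<close> is the entry \<open>a $ 2 $ 1\<close>.
\<close>

definition beta_vanishes :: "real \<Rightarrow> ('p \<Rightarrow> complex ^ 2) \<Rightarrow> 'p \<Rightarrow> bool" where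
  "beta_vanishes v \<Phi> p \<longleftrightarrow> (\<forall>g\<in>phi v \<Phi> p. fst g $ 2 $ 1 = 0)"


subsection \<open>Well-definedness of the decomposition\<close>

lemma U1_iff: "z \<in> U1 \<longleftrightarrow> cmod z = 1"
proof
  assume "z \<in> U1" then show "cmod z = 1" by (auto simp: U1_def u1_def)
next
  assume z: "cmod z = 1"
  have "z = cis (Arg2pi z)"
    using z Arg2pi_eq[of z] by (simp add: cis_conv_exp mult.commute)
  then have "z = u1 (2 * Arg2pi z)" by (simp add: u1_def)
  moreover have "2 * Arg2pi z \<in> {0..<4 * pi}"
    using Arg2pi_ge_0[of z] Arg2pi_lt_2pi[of z] by auto
  ultimately show "z \<in> U1" unfolding U1_def by blast
qed

lemma SU2_entries:
  assumes "a \<in> SU2"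
  shows "a $ 2 $ 2 = cnj (a $ 1 $ 1)" and "a $ 1 $ 2 = - cnj (a $ 2 $ 1)"
    and "cnj (a $ 1 $ 1) * a $ 1 $ 1 + cnj (a $ 2 $ 1) * a $ 2 $ 1 = 1"
proof -
  define p q r s where "p = a $ 1 $ 1" "q = a $ 1 $ 2" "r = a $ 2 $ 1" "s = a $ 2 $ 2"
  note d = this
  have u: "adjoint_mat a ** a = mat 1" and det: "det a = 1"
    using assms by (auto simp: SU2_def)
  have 1: "cnj p * p + cnj r * r = 1"
    using arg_cong[OF u, of "\<lambda>m. m $ 1 $ 1"]
    by (simp add: matrix_matrix_mult_def adjoint_mat_def sum_2 mat_def d)
  have 2: "cnj p * q + cnj r * s = 0"
    using arg_cong[OF u, of "\<lambda>m. m $ 1 $ 2"]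
    by (simp add: matrix_matrix_mult_def adjoint_mat_def sum_2 mat_def d)
  have 3: "p * s - q * r = 1" using det by (simp add: det_2 d)
  have "s = cnj p" using 1 2 3 by algebra
  moreover have "q = - cnj r" using 1 2 3 by algebra
  ultimately show "a $ 2 $ 2 = cnj (a $ 1 $ 1)" "a $ 1 $ 2 = - cnj (a $ 2 $ 1)"
    by (simp_all add: d)
  show "cnj (a $ 1 $ 1) * a $ 1 $ 1 + cnj (a $ 2 $ 1) * a $ 2 $ 1 = 1" using 1 by (simp add: d)
qed

lemma SU2_intro:
  assumes "cnj x * x + cnj y * y = 1"
  shows "(\<chi> i j. if i = 1 then (if j = 1 then x else - cnj y) else (if j = 1 then y else cnj x)) \<in> SU2"
  using assms
  by (auto simp: SU2_def adjoint_mat_def det_2 vec_eq_iff forall_2 matrix_matrix_mult_def sum_2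
      mat_def algebra_simps)

lemma rho_base:
  "rho g (vector [0, complex_of_real v]) = vector [snd g * fst g $ 1 $ 2 * v, snd g * fst g $ 2 $ 2 * v]"
  by (simp add: rho_def vec_eq_iff forall_2 matrix_vector_mult_def sum_2)

lemma K_eq: "K = {(diag2 z (cnj z), z) | z. cmod z = 1}"
proof -
  have "K = (\<lambda>z. (diag2 z (cnj z), z)) ` U1"
    by (auto simp: K_def U1_def u1_def cis_cnj image_image intro!: image_eqI)
  then show ?thesis by (simp add: U1_iff image_def Bex_def) blast
qed

text \<open>\<open>K\<close> is the stabilizer of \<open>(0, v)\<close>.\<close>

lemma K_stabilizer:
  assumes "v \<noteq> 0"
  shows "K = {g \<in> G. rho g (vector [0, complex_of_real v]) = vector [0, complex_of_real v]}"
proof -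
  have "g \<in> K \<longleftrightarrow> g \<in> G \<and> snd g * fst g $ 1 $ 2 = 0 \<and> snd g * fst g $ 2 $ 2 = 1" for g
  proof
    assume "g \<in> K"
    then obtain z where z: "g = (diag2 z (cnj z), z)" "cmod z = 1" by (auto simp: K_eq)
    have zz: "cnj z * z = 1" "z * cnj z = 1" using z(2)
      by (metis complex_norm_square mult.commute of_real_1 one_power2)+
    have "diag2 z (cnj z) \<in> SU2"
      using SU2_intro[of z 0] zz(1) by (auto simp: diag2_def vec_eq_iff forall_2 elim!: back_subst[of "\<lambda>x. x \<in> SU2"])
    then show "g \<in> G \<and> snd g * fst g $ 1 $ 2 = 0 \<and> snd g * fst g $ 2 $ 2 = 1"
      using z zz by (auto simp: G_def U1_iff diag2_def)
  next
    assume g: "g \<in> G \<and> snd g * fst g $ 1 $ 2 = 0 \<and> snd g * fst g $ 2 $ 2 = 1"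
    obtain a z where az: "g = (a, z)" by force
    have a: "a \<in> SU2" and z: "cmod z = 1" using g az by (auto simp: G_def U1_iff)
    have zz: "cnj z * z = 1" using z
      by (metis complex_norm_square mult.commute of_real_1 one_power2)
    have "z \<noteq> 0" using z by auto
    then have 0: "a $ 1 $ 2 = 0" and "z * a $ 2 $ 2 = 1" using g az by auto
    then have 2: "a $ 2 $ 2 = cnj z" using zz by algebra
    have 3: "a $ 2 $ 1 = 0" using SU2_entries(2)[OF a] 0 by auto
    have "a $ 1 $ 1 = z" using SU2_entries(1)[OF a] 2 by (metis complex_cnj_cnj)
    then have "a = diag2 z (cnj z)" using 0 2 3 by (auto simp: diag2_def vec_eq_iff forall_2)
    then show "g \<in> K" using az z by (auto simp: K_eq)
  qed
  then show ?thesis using assms by (auto simp: rho_base vec_eq_iff forall_2)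
qed

lemma rho_gmul: "rho (gmul g h) w = rho g (rho h w)"
  by (simp add: rho_def gmul_def vec_eq_iff forall_2 matrix_vector_mult_def
      matrix_matrix_mult_def sum_2 algebra_simps)

lemma gmul_assoc: "gmul (gmul g h) k = gmul g (gmul h k)"
  by (simp add: gmul_def matrix_mul_assoc mult.assoc)

lemma gmul_closed: "g \<in> G \<Longrightarrow> h \<in> G \<Longrightarrow> gmul g h \<in> G"
proof -
  have "adjoint_mat (a ** b) ** (a ** b) = adjoint_mat b ** ((adjoint_mat a ** a) ** b)" for a b
    by (simp add: adjoint_mat_def vec_eq_iff forall_2 matrix_matrix_mult_def sum_2 algebra_simps)
  then show "g \<in> G \<Longrightarrow> h \<in> G \<Longrightarrow> gmul g h \<in> G"
    by (auto simp: G_def gmul_def SU2_def U1_iff det_mul norm_mult)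
qed

lemma ginv_closed: "g \<in> G \<Longrightarrow> ginv g \<in> G"
proof -
  have "adjoint_mat (adjoint_mat a) = a" "det (adjoint_mat a) = cnj (det a)" for a
    by (simp_all add: adjoint_mat_def vec_eq_iff forall_2 det_2)
  then show "g \<in> G \<Longrightarrow> ginv g \<in> G"
    by (auto simp: G_def ginv_def SU2_def U1_iff matrix_left_right_inverse)
qed

lemma gmul_ginv:
  assumes "g \<in> G"
  shows "gmul (ginv g) g = gone" and "gmul g (ginv g) = gone"
proof -
  have "adjoint_mat (fst g) ** fst g = mat 1" and "cmod (snd g) = 1"
    using assms by (auto simp: G_def SU2_def U1_iff)
  moreover from this have "snd g * cnj (snd g) = 1"
    by (metis complex_norm_square of_real_1 one_power2)
  ultimately show "gmul (ginv g) g = gone" "gmul g (ginv g) = gone"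
    by (auto simp: gmul_def ginv_def gone_def mult.commute matrix_left_right_inverse)
qed

lemma gone_simps: "gmul gone g = g" "rho gone w = w"
  by (simp_all add: gmul_def gone_def rho_def)

lemma norm_rho_base:
  assumes "g \<in> G"
  shows "norm (rho g (vector [0, complex_of_real v])) = \<bar>v\<bar>"
proof -
  define a z where "a = fst g" "z = snd g"
  have a: "a \<in> SU2" and z: "cmod z = 1" using assms by (auto simp: G_def U1_iff a_z_def)
  have "complex_of_real ((cmod (a $ 1 $ 1))\<^sup>2 + (cmod (a $ 2 $ 1))\<^sup>2) = 1"
    using SU2_entries(3)[OF a] by (metis complex_norm_square mult.commute of_real_add)
  then have 1: "(cmod (a $ 1 $ 1))\<^sup>2 + (cmod (a $ 2 $ 1))\<^sup>2 = 1"
    by (metis of_real_eq_1_iff)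
  have "(norm (rho g (vector [0, complex_of_real v])))\<^sup>2 =
      ((cmod (a $ 1 $ 1))\<^sup>2 + (cmod (a $ 2 $ 1))\<^sup>2) * v\<^sup>2"
    using SU2_entries(1,2)[OF a] z
    by (simp add: rho_base norm_vec_def L2_set_def sum_2 norm_mult power_mult_distrib
        algebra_simps flip: a_z_def)
  then show ?thesis using 1 by (metis mult_1 norm_ge_zero real_sqrt_abs real_sqrt_unique)
qed

lemma polar_decomposition:
  assumes "v \<noteq> 0" and "\<Phi> p \<noteq> 0"
  shows "\<exists>!\<eta>. \<eta> > 0 \<and> (\<exists>g\<in>G. \<Phi> p = (\<eta> / sqrt 2) *\<^sub>R rho g (vector [0, complex_of_real v]))"
    and "\<exists>g\<in>G. phi v \<Phi> p = coset_K g"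
    and "g \<in> phi v \<Phi> p \<Longrightarrow> beta_vanishes v \<Phi> p \<longleftrightarrow> fst g $ 2 $ 1 = 0"
proof -
  define e where "e = (vector [0, complex_of_real v] :: complex ^ 2)"
  define r where "r = sqrt 2 * norm (\<Phi> p) / \<bar>v\<bar>"
  have r: "r > 0" using assms by (simp add: r_def)
  have r_unique: "\<eta> = r" if "\<eta> > 0" "g \<in> G" "\<Phi> p = (\<eta> / sqrt 2) *\<^sub>R rho g e" for \<eta> g
  proof -
    have "norm (\<Phi> p) = \<eta> / sqrt 2 * \<bar>v\<bar>"
      using that norm_rho_base[of g v] by (simp add: e_def)
    then show ?thesis using assms(1) by (simp add: r_def)
  qed
  define u where "u = (sgn v / norm (\<Phi> p)) *\<^sub>R \<Phi> p"
  define x y where "x = cnj (u $ 2)" "y = - cnj (u $ 1)"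
  define a where
    "a = (\<chi> i j. if i = (1::2) then (if j = (1::2) then x else - cnj y) else (if j = 1 then y else cnj x))"
  have "norm u = 1" using assms by (simp add: u_def abs_sgn_eq)
  then have "(cmod (u $ 1))\<^sup>2 + (cmod (u $ 2))\<^sup>2 = 1"
    by (simp add: norm_vec_def L2_set_def sum_2)
  then have "complex_of_real ((cmod (u $ 1))\<^sup>2 + (cmod (u $ 2))\<^sup>2) = 1" by simp
  then have "cnj x * x + cnj y * y = 1"
    unfolding of_real_add complex_norm_square by (simp add: x_y_def algebra_simps)
  then have g0: "(a, 1) \<in> G" using SU2_intro by (simp add: G_def U1_iff a_def)
  have "rho (a, 1) e = v *\<^sub>R u"
    by (simp add: e_def rho_base a_def x_y_def vec_eq_iff forall_2, simp add: scaleR_conv_of_real)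
  also have "\<dots> = (\<bar>v\<bar> / norm (\<Phi> p)) *\<^sub>R \<Phi> p"
    by (simp add: u_def abs_sgn mult.commute)
  finally have ex: "\<Phi> p = (r / sqrt 2) *\<^sub>R rho (a, 1) e"
    using assms by (simp add: r_def)
  show "\<exists>!\<eta>. \<eta> > 0 \<and> (\<exists>g\<in>G. \<Phi> p = (\<eta> / sqrt 2) *\<^sub>R rho g (vector [0, complex_of_real v]))"
    using r ex g0 r_unique unfolding e_def by blast
  have phi_iff: "g \<in> phi v \<Phi> p \<longleftrightarrow> g \<in> G \<and> \<Phi> p = (r / sqrt 2) *\<^sub>R rho g e" for g
    unfolding phi_def e_def[symmetric] mem_Collect_eq using r r_unique by blast
  have coset: "phi v \<Phi> p = coset_K g" if g: "g \<in> phi v \<Phi> p" for g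
  proof (intro set_eqI iffI)
    fix h assume h: "h \<in> phi v \<Phi> p"
    have "(r / sqrt 2) *\<^sub>R rho h e = (r / sqrt 2) *\<^sub>R rho g e"
      using g h unfolding phi_iff by metis
    then have eq: "rho h e = rho g e" using r by simp
    have G: "g \<in> G" "h \<in> G" using g h by (auto simp: phi_iff)
    have "rho (gmul (ginv g) h) e = e"
      by (metis eq G(1) gmul_ginv(1) gone_simps(2) rho_gmul)
    then have "gmul (ginv g) h \<in> K"
      using G gmul_closed ginv_closed unfolding K_stabilizer[OF assms(1)] e_def by blast
    moreover have "h = gmul g (gmul (ginv g) h)"
      by (metis G(1) gmul_assoc gmul_ginv(2) gone_simps(1))
    ultimately show "h \<in> coset_K g" unfolding coset_K_def by blast
  next
    fix h assume "h \<in> coset_K g"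
    then obtain k where k: "k \<in> K" "h = gmul g k" unfolding coset_K_def by blast
    then have "k \<in> G" "rho k e = e" using K_stabilizer[OF assms(1)] by (auto simp: e_def)
    then show "h \<in> phi v \<Phi> p" using g k by (simp add: phi_iff gmul_closed rho_gmul)
  qed
  show "\<exists>g\<in>G. phi v \<Phi> p = coset_K g" using coset[of "(a, 1)"] g0 ex by (auto simp: phi_iff)
  assume g: "g \<in> phi v \<Phi> p"
  show "beta_vanishes v \<Phi> p \<longleftrightarrow> fst g $ 2 $ 1 = 0"
  proof
    assume "fst g $ 2 $ 1 = 0"
    then show "beta_vanishes v \<Phi> p"
      unfolding beta_vanishes_def coset[OF g] coset_K_def K_eq
      by (auto simp: gmul_def matrix_matrix_mult_def sum_2 diag2_def)
  qed (use g in \<open>auto simp: beta_vanishes_def\<close>)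
qed

end

theory Submission
  imports Defs
begin

text \<open>
  A gauge transformation \<open>l\<close> fixes \<open>A\<close> exactly if it solves \<open>dl = l A - A l\<close>, an equation that
  makes sense for fields with values in the ambient algebra \<open>\<complex>\<^sup>2\<^sup>\<times>\<^sup>2 \<times> \<complex>\<close>
  (\<open>Gau_A_iff\<close>).  Its equivariant solutions, called covariantly constant below, form a real algebra,
  and each of them is constant on the holonomy bundle \<open>P\<^sub>A\<close>.  Every point of \<open>P\<close> is
  \<open>q \<cdot> g\<close> with \<open>q \<in> P\<^sub>A\<close> (\<open>holonomy_bundle_covers_base\<close>), so all pointwise questions about a
  covariantly constant \<open>l\<close> reduce to its value at \<open>p\<^sub>0\<close>.

  If \<open>l\<close> fixes \<open>(A, \<Phi>)\<close> and \<open>\<phi>(p) = [g]\<close> with \<open>p \<in> P\<^sub>A\<close>, then \<open>k = l(p\<^sub>0) = l(p)\<close> lies in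
  \<open>g K g\<^sup>-\<^sup>1\<close>; for \<open>p = p\<^sub>0\<close> this says \<open>k = (diag(z, cnj z), z) \<in> K\<close>.  Conjugation does not
  change the \<open>U(1)\<close> component \<open>z\<close>, which determines an element of \<open>K\<close>, so \<open>k\<close> has to commute with
  \<open>g\<close>: either \<open>z\<close> is real, that is \<open>k \<in> Z2\<close>, or \<open>\<beta>(p) = 0\<close> (\<open>K_conjugate\<close>).  A stabilizer that is
  larger than \<open>Z2\<close> therefore forces \<open>\<beta> = 0\<close> on \<open>P\<^sub>A\<close>.

  It also restricts the stabilizer of \<open>A\<close>.  Regard \<open>SU(2)\<close> as the unit quaternions and let \<open>a\<close> be the
  \<open>SU(2)\<close> part of an \<open>l\<close> whose \<open>z\<close> is not real.  The real combinations of \<open>1\<close> and \<open>a(p\<^sub>0)\<close> are all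
  diagonal quaternions, and if some \<open>b\<close> in the stabilizer is not diagonal at \<open>p\<^sub>0\<close>, then those of
  \<open>1, a, b, a b\<close> are all quaternions.  Real combinations of covariantly constant fields are
  covariantly constant, and one that is a unit at \<open>p\<^sub>0\<close> is a unit everywhere, because its values are
  conjugate to the one at \<open>p\<^sub>0\<close>.  So the stabilizer of \<open>A\<close> is \<open>U(1) \<times> U(1)\<close> or
  \<open>SU(2) \<times> U(1)\<close> (\<open>Gau_A_with_noncentral_diagonal\<close>).

  Conversely, under the two conditions every \<open>k \<in> K\<close> is the value at \<open>p\<^sub>0\<close> of some \<open>l\<close> fixing \<open>A\<close>,
  and \<open>k\<close> fixes \<open>\<Phi>\<close> on \<open>P\<^sub>A\<close>; by equivariance \<open>l\<close> fixes \<open>\<Phi>\<close> everywhere.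

  The analytic part is the existence of enough horizontal paths: in a local trivialization the
  horizontal lift of a curve is a solution of \<open>g' = - B g\<close> with \<open>B\<close> in the Lie algebra
  (\<open>horizontal_lift\<close>), a linear equation, solved by a contraction (\<open>linear_ode_solution\<close>).
\<close>

section \<open>Calculus of smooth maps\<close>

lemma C_on_cong:
  assumes "open S" "\<And>x. x \<in> S \<Longrightarrow> f x = g x" "C_on k S f"
  shows "C_on k S g"
  using assms(2,3)
proof (induction k arbitrary: f g)
  case 0
  then show ?case using continuous_on_cong by force
next
  case (Suc k)
  have d: "(g has_derivative frechet_derivative f (at x)) (at x)" if "x \<in> S" for x
  proof (rule has_derivative_transform_within_open[OF _ assms(1) that])
    show "(f has_derivative frechet_derivative f (at x)) (at x)"
      using Suc.prems(2) that frechet_derivative_works by auto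
  qed (rule Suc.prems(1))
  have "C_on k S (\<lambda>x. frechet_derivative g (at x) u)" for u
  proof (rule Suc.IH[of "\<lambda>x. frechet_derivative f (at x) u"])
    show "frechet_derivative f (at x) u = frechet_derivative g (at x) u" if "x \<in> S" for x
      by (rule fun_cong[OF frechet_derivative_at[OF d[OF that]]])
    show "C_on k S (\<lambda>x. frechet_derivative f (at x) u)" using Suc.prems(2) by simp
  qed
  moreover have "g differentiable (at x)" if "x \<in> S" for x
    using d[OF that] unfolding differentiable_def by blast
  ultimately show ?case by simp
qed

lemma C_on_subset: "C_on k S f \<Longrightarrow> T \<subseteq> S \<Longrightarrow> C_on k T f"
  by (induction k arbitrary: f) (auto intro: continuous_on_subset)

lemma C_on_SucD: "C_on (Suc k) S f \<Longrightarrow> C_on k S f"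
proof (induction k arbitrary: f)
  case 0
  then show ?case
    by (auto intro!: continuous_at_imp_continuous_on differentiable_imp_continuous_within)
qed (metis C_on.simps(2))

lemma C_on_const: "C_on k S (\<lambda>x. c)"
proof (induction k arbitrary: c)
  case (Suc k)
  have "frechet_derivative (\<lambda>x. c) (at x) = (\<lambda>u. 0)" for x :: 'a
    by (metis frechet_derivative_at has_derivative_const)
  then show ?case using Suc by simp
qed simp

lemma C_on_add:
  assumes "open S" "C_on k S f" "C_on k S g"
  shows "C_on k S (\<lambda>x. f x + g x)"
  using assms(2,3)
proof (induction k arbitrary: f g)
  case 0
  then show ?case by (auto intro: continuous_intros)
next
  case (Suc k)
  have d: "((\<lambda>x. f x + g x) has_derivative
      (\<lambda>u. frechet_derivative f (at x) u + frechet_derivative g (at x) u)) (at x)"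
    if "x \<in> S" for x
    using Suc.prems that by (auto intro!: has_derivative_add simp flip: frechet_derivative_works)
  have "C_on k S (\<lambda>x. frechet_derivative (\<lambda>x. f x + g x) (at x) u)" for u
    by (rule C_on_cong[OF assms(1) _ Suc.IH[of "\<lambda>x. frechet_derivative f (at x) u"
          "\<lambda>x. frechet_derivative g (at x) u"]])
      (use Suc.prems in \<open>auto simp flip: frechet_derivative_at[OF d]\<close>)
  then show ?case using d by (auto simp: differentiable_def)
qed

lemma C_on_bilinear:
  assumes "bounded_bilinear mul" "open S" "C_on k S f" "C_on k S g"
  shows "C_on k S (\<lambda>x. mul (f x) (g x))"
  using assms(3,4)
proof (induction k arbitrary: f g)
  case 0
  then show ?case using bounded_bilinear.continuous_on[OF assms(1)] by auto
next
  case (Suc k)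
  have d: "((\<lambda>x. mul (f x) (g x)) has_derivative
      (\<lambda>u. mul (f x) (frechet_derivative g (at x) u) + mul (frechet_derivative f (at x) u) (g x)))
      (at x)"
    if "x \<in> S" for x
    using Suc.prems that
    by (auto intro!: bounded_bilinear.FDERIV[OF assms(1)] simp flip: frechet_derivative_works)
  have "C_on k S (\<lambda>x. frechet_derivative (\<lambda>x. mul (f x) (g x)) (at x) u)" for u
    by (rule C_on_cong[OF assms(2) _ C_on_add[OF assms(2) Suc.IH[of "f" "\<lambda>x. frechet_derivative g (at x) u"]
          Suc.IH[of "\<lambda>x. frechet_derivative f (at x) u" g]]])
      (use Suc.prems C_on_SucD in \<open>auto simp flip: frechet_derivative_at[OF d]\<close>)
  then show ?case using d by (auto simp: differentiable_def)
qed

lemma C_on_linear: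
  assumes "bounded_linear L" "open S" "C_on k S f"
  shows "C_on k S (\<lambda>x. L (f x))"
  using assms(3)
proof (induction k arbitrary: f)
  case 0
  then show ?case using bounded_linear.continuous_on[OF assms(1)] by auto
next
  case (Suc k)
  have d: "((\<lambda>x. L (f x)) has_derivative (\<lambda>u. L (frechet_derivative f (at x) u))) (at x)"
    if "x \<in> S" for x
    using Suc.prems that
    by (auto intro!: bounded_linear.has_derivative[OF assms(1)] simp flip: frechet_derivative_works)
  have "C_on k S (\<lambda>x. frechet_derivative (\<lambda>x. L (f x)) (at x) u)" for u
    by (rule C_on_cong[OF assms(2) _ Suc.IH[of "\<lambda>x. frechet_derivative f (at x) u"]])
      (use Suc.prems in \<open>auto simp flip: frechet_derivative_at[OF d]\<close>)
  then show ?case using d by (auto simp: differentiable_def)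
qed

lemma smooth_onE:
  assumes "smooth_on S f" "x \<in> S"
  obtains W F where "open W" "x \<in> W" "\<And>k. C_on k W F" "\<And>y. y \<in> W \<Longrightarrow> y \<in> S \<Longrightarrow> F y = f y"
  using assms unfolding smooth_on_def by (metis IntI)

lemma smooth_on_const: "smooth_on S (\<lambda>x. c)"
  unfolding smooth_on_def using C_on_const open_UNIV by blast

lemma smooth_on_linear:
  assumes "bounded_linear L" "smooth_on S f"
  shows "smooth_on S (\<lambda>x. L (f x))"
  unfolding smooth_on_def
proof
  fix x assume "x \<in> S"
  then obtain W F where "open W" "x \<in> W" "\<And>k. C_on k W F" "\<And>y. y \<in> W \<Longrightarrow> y \<in> S \<Longrightarrow> F y = f y"
    using smooth_onE[OF assms(2)] by metis
  then show "\<exists>W F. open W \<and> x \<in> W \<and> (\<forall>k. C_on k W F) \<and> (\<forall>y\<in>W \<inter> S. F y = L (f y))"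
    using C_on_linear[OF assms(1) \<open>open W\<close>]
    by (intro exI[of _ W] exI[of _ "\<lambda>x. L (F x)"]) auto
qed

text \<open>
  The pattern shared by sums and products: local smooth extensions of the two factors are combined
  on the intersection of their domains.
\<close>

lemma smooth_on_combine:
  fixes S :: "'a::euclidean_space set"
  assumes "smooth_on S f" "smooth_on S g"
    and "\<And>k (W :: 'a set) F H. open W \<Longrightarrow> C_on k W F \<Longrightarrow> C_on k W H \<Longrightarrow> C_on k W (\<lambda>x. op (F x) (H x))"
  shows "smooth_on S (\<lambda>x. op (f x) (g x))"
  unfolding smooth_on_def
proof
  fix x assume x: "x \<in> S"
  obtain V F where F: "open V" "x \<in> V" "\<And>k. C_on k V F" "\<And>y. y \<in> V \<Longrightarrow> y \<in> S \<Longrightarrow> F y = f y"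
    using smooth_onE[OF assms(1) x] by metis
  obtain W H where H: "open W" "x \<in> W" "\<And>k. C_on k W H" "\<And>y. y \<in> W \<Longrightarrow> y \<in> S \<Longrightarrow> H y = g y"
    using smooth_onE[OF assms(2) x] by metis
  have "C_on k (V \<inter> W) (\<lambda>x. op (F x) (H x))" for k
    using F H by (intro assms(3)) (auto intro: C_on_subset)
  then show "\<exists>W F. open W \<and> x \<in> W \<and> (\<forall>k. C_on k W F) \<and> (\<forall>y\<in>W \<inter> S. F y = op (f y) (g y))"
    using F H by (intro exI[of _ "V \<inter> W"] exI[of _ "\<lambda>x. op (F x) (H x)"]) auto
qed

lemma smooth_on_add: "smooth_on S f \<Longrightarrow> smooth_on S g \<Longrightarrow> smooth_on S (\<lambda>x. f x + g x)"
  by (rule smooth_on_combine[where op = "(+)"]) (auto intro: C_on_add)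

lemma smooth_on_bilinear:
  assumes "bounded_bilinear mul" "smooth_on S f" "smooth_on S g"
  shows "smooth_on S (\<lambda>x. mul (f x) (g x))"
  by (rule smooth_on_combine[OF assms(2,3), where op = mul]) (rule C_on_bilinear[OF assms(1)])

lemma C_on_derivative:
  assumes "\<And>k. C_on k W F" "x \<in> W"
  shows "(F has_derivative frechet_derivative F (at x)) (at x)"
  using assms(1)[of "Suc 0"] assms(2) by (simp flip: frechet_derivative_works)

lemma linear_basis_expansion:
  assumes "linear L"
  shows "L v = (\<Sum>b\<in>Basis. (v \<bullet> b) *\<^sub>R L b)"
proof -
  have "L v = L (\<Sum>b\<in>Basis. (v \<bullet> b) *\<^sub>R b)" by (simp only: euclidean_representation)
  then show ?thesis using assms by (simp add: linear_sum linear_cmul)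
qed

text \<open>
  Near each parameter the curve can be composed with a smooth local extension of \<open>f\<close>.  The
  derivative is expanded in a basis because \<open>C_on\<close> provides continuity of the derivative of the
  extension in each fixed direction only.
\<close>

lemma smooth_on_C1_curve:
  fixes \<kappa> :: "real \<Rightarrow> 'a::euclidean_space" and f :: "'a \<Rightarrow> 'b::euclidean_space"
  assumes f: "smooth_on S f" and J: "open J" and S: "\<And>t. t \<in> J \<Longrightarrow> \<kappa> t \<in> S"
    and \<kappa>: "\<And>t. t \<in> J \<Longrightarrow> (\<kappa> has_vector_derivative \<kappa>' t) (at t)" "continuous_on J \<kappa>'"
  shows "\<And>t. t \<in> J \<Longrightarrow> (\<lambda>t. f (\<kappa> t)) differentiable (at t)"
    and "continuous_on J (\<lambda>t. vector_derivative (\<lambda>t. f (\<kappa> t)) (at t))"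
proof -
  have \<kappa>_cont: "continuous_on J \<kappa>"
    using \<kappa>(1) by (meson continuous_at_imp_continuous_on has_vector_derivative_continuous)
  have *: "\<exists>I v. open I \<and> t0 \<in> I \<and> continuous_on I v \<and>
      (\<forall>t\<in>I. ((\<lambda>t. f (\<kappa> t)) has_vector_derivative v t) (at t))" if t0: "t0 \<in> J" for t0
  proof -
    obtain W F where F: "open W" "\<kappa> t0 \<in> W" "\<And>k. C_on k W F" "\<And>y. y \<in> W \<Longrightarrow> y \<in> S \<Longrightarrow> F y = f y"
      using smooth_onE[OF f S[OF t0]] by metis
    define I where "I = J \<inter> \<kappa> -` W"
    have I: "open I" unfolding I_def using J F(1) \<kappa>_cont by (metis continuous_on_open_vimage inf_commute)
    define v where "v t = (\<Sum>b\<in>Basis. (\<kappa>' t \<bullet> b) *\<^sub>R frechet_derivative F (at (\<kappa> t)) b)" for t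
    have "continuous_on I (\<lambda>t. frechet_derivative F (at (\<kappa> t)) b)" for b
    proof -
      have "continuous_on W (\<lambda>x. frechet_derivative F (at x) b)"
        using F(3)[of "Suc 0"] by simp
      then show ?thesis
        by (rule continuous_on_compose2) (use \<kappa>_cont in \<open>auto simp: I_def intro: continuous_on_subset\<close>)
    qed
    then have v: "continuous_on I v"
      unfolding v_def
      by (intro continuous_intros continuous_on_subset[OF \<kappa>(2)]) (auto simp: I_def)
    have "((\<lambda>t. f (\<kappa> t)) has_vector_derivative v t) (at t)" if t: "t \<in> I" for t
    proof -
      have F': "(F has_derivative frechet_derivative F (at (\<kappa> t))) (at (\<kappa> t))"
        using C_on_derivative[OF F(3)] t by (auto simp: I_def)
      have "v t = frechet_derivative F (at (\<kappa> t)) (\<kappa>' t)"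
        unfolding v_def by (rule linear_basis_expansion[OF has_derivative_linear[OF F'], symmetric])
      moreover have "((F \<circ> \<kappa>) has_vector_derivative frechet_derivative F (at (\<kappa> t)) (\<kappa>' t)) (at t)"
        using \<kappa>(1) t F' vector_derivative_diff_chain_within[of \<kappa> "\<kappa>' t" t UNIV F]
        by (auto simp: I_def intro: has_derivative_at_withinI)
      ultimately have "((F \<circ> \<kappa>) has_vector_derivative v t) (at t)" by simp
      then show ?thesis
        by (rule has_vector_derivative_transform_within_open[OF _ I t])
          (use F(4) S in \<open>auto simp: I_def\<close>)
    qed
    then show ?thesis using I v t0 F(2) I_def by blast
  qed
  show "(\<lambda>t. f (\<kappa> t)) differentiable (at t)" if "t \<in> J" for t
    using *[OF that] by (metis differentiableI_vector)
  show "continuous_on J (\<lambda>t. vector_derivative (\<lambda>t. f (\<kappa> t)) (at t))"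
  proof (rule continuous_at_imp_continuous_on, rule ballI)
    fix t0 assume "t0 \<in> J"
    then obtain I v where I: "open I" "t0 \<in> I" "continuous_on I v"
      "\<forall>t\<in>I. ((\<lambda>t. f (\<kappa> t)) has_vector_derivative v t) (at t)" using * by metis
    then have "continuous_on I (\<lambda>t. vector_derivative (\<lambda>t. f (\<kappa> t)) (at t))"
      by (metis (no_types, lifting) continuous_on_cong vector_derivative_at)
    then show "continuous (at t0) (\<lambda>t. vector_derivative (\<lambda>t. f (\<kappa> t)) (at t))"
      using I(1,2) by (simp add: continuous_on_eq_continuous_at)
  qed
qed

lemma smooth_on_open_derivative:
  assumes "smooth_on S f" "open S" "x \<in> S"
  shows "(f has_derivative frechet_derivative f (at x)) (at x)"
proof -
  obtain W F where F: "open W" "x \<in> W" "\<And>k. C_on k W F" "\<And>y. y \<in> W \<Longrightarrow> y \<in> S \<Longrightarrow> F y = f y"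
    using smooth_onE[OF assms(1,3)] by metis
  have "(f has_derivative frechet_derivative F (at x)) (at x)"
    by (rule has_derivative_transform_within_open[OF C_on_derivative[OF F(3,2)], of "W \<inter> S"])
      (use F assms in auto)
  then show ?thesis using frechet_derivative_works differentiableI by blast
qed

lemma smooth_on_open_continuous:
  assumes "smooth_on S f" "open S"
  shows "continuous_on S f"
  using smooth_on_open_derivative[OF assms] 
  by (meson continuous_at_imp_continuous_on has_derivative_continuous)

text \<open>
  The derivative of a smooth extension at \<open>x\<close> acts on the velocities of all curves in \<open>S\<close> through
  \<open>x\<close>.  The extension is not unique on a lower dimensional \<open>S\<close>, but one and the same linear map
  serves all these curves, so that their derivatives may be added.
\<close>

lemma smooth_on_chain:
  fixes f :: "'a::euclidean_space \<Rightarrow> 'b::euclidean_space"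
  assumes "smooth_on S f" "x \<in> S"
  obtains F' where "linear F'"
    "\<And>\<kappa> t v. \<kappa> t = x \<Longrightarrow> (\<kappa> has_vector_derivative v) (at t) \<Longrightarrow> \<forall>\<^sub>F \<tau> in nhds t. \<kappa> \<tau> \<in> S \<Longrightarrow>
      ((\<lambda>\<tau>. f (\<kappa> \<tau>)) has_vector_derivative F' v) (at t)"
proof -
  obtain W F where F: "open W" "x \<in> W" "\<And>k. C_on k W F" "\<And>y. y \<in> W \<Longrightarrow> y \<in> S \<Longrightarrow> F y = f y"
    using smooth_onE[OF assms] by metis
  have F': "(F has_derivative frechet_derivative F (at x)) (at x)"
    by (rule C_on_derivative[OF F(3,2)])
  show ?thesis
  proof
    show "linear (frechet_derivative F (at x))" using F' by (rule has_derivative_linear)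
    fix \<kappa> :: "real \<Rightarrow> 'a" and t v
    assume \<kappa>: "\<kappa> t = x" "(\<kappa> has_vector_derivative v) (at t)" "\<forall>\<^sub>F \<tau> in nhds t. \<kappa> \<tau> \<in> S"
    have "((F \<circ> \<kappa>) has_vector_derivative frechet_derivative F (at x) v) (at t)"
      using \<kappa>(1,2) F' by (intro vector_derivative_diff_chain_within) (auto intro: has_derivative_at_withinI)
    moreover have "\<forall>\<^sub>F \<tau> in at t. (F \<circ> \<kappa>) \<tau> = f (\<kappa> \<tau>)"
    proof -
      have "(\<kappa> \<longlongrightarrow> x) (at t)"
        using has_vector_derivative_continuous[OF \<kappa>(2)] \<kappa>(1) by (simp add: continuous_at)
      then have "\<forall>\<^sub>F \<tau> in at t. \<kappa> \<tau> \<in> W" using F(1,2) by (rule topological_tendstoD)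
      moreover have "\<forall>\<^sub>F \<tau> in at t. \<kappa> \<tau> \<in> S"
        using \<kappa>(3) by (auto simp: eventually_at_filter elim: eventually_mono)
      ultimately show ?thesis by eventually_elim (use F(4) in auto)
    qed
    ultimately show "((\<lambda>\<tau>. f (\<kappa> \<tau>)) has_vector_derivative frechet_derivative F (at x) v) (at t)"
      unfolding has_vector_derivative_def
      by (rule has_derivative_transform_eventually) (use F(2,4) assms(2) \<kappa>(1) in auto)
  qed
qed

section \<open>Linear differential equations\<close>

text \<open>
  Picard iteration for the weighted unknown \<open>w(t) = exp(-L t) y(t)\<close>.  If \<open>C\<close> bounds \<open>B\<close>, the
  integral operator is a contraction with constant \<open>C / L\<close>, however long the interval;
  \<open>L = 2 C\<close> gives \<open>1/2\<close>.
\<close>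

lemma linear_ode_solution:
  fixes mul :: "'c::real_normed_vector \<Rightarrow> 'b::banach \<Rightarrow> 'b"
  assumes bil: "bounded_bilinear mul" and B: "continuous_on {a..b} B" and ab: "a \<le> b"
  obtains y where "y a = y0"
    "\<And>t. t \<in> {a..b} \<Longrightarrow> (y has_vector_derivative mul (B t) (y t)) (at t within {a..b})"
proof -
  interpret bounded_bilinear mul by (rule bil)
  obtain k where k: "k > 0" "\<And>x y. norm (mul x y) \<le> norm x * norm y * k"
    using pos_bounded by metis
  have "bounded (B ` {a..b})"
    using B by (intro compact_imp_bounded compact_continuous_image) auto
  then obtain C0 where C0: "\<And>t. t \<in> {a..b} \<Longrightarrow> norm (B t) \<le> C0"
    unfolding bounded_iff by blast
  define C where "C = (\<bar>C0\<bar> + 1) * k"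
  have C: "C > 0" using k by (simp add: C_def)
  have prod_le: "norm (mul (B t) x) \<le> C * norm x" if "t \<in> {a..b}" for t x
  proof -
    have "norm (mul (B t) x) \<le> norm (B t) * norm x * k" by (rule k)
    also have "\<dots> \<le> (\<bar>C0\<bar> + 1) * norm x * k"
      using C0[OF that] k(1) by (intro mult_right_mono) auto
    finally show ?thesis by (simp add: C_def mult_ac)
  qed
  define L where "L = 2 * C"
  have L: "L > 0" using C by (simp add: L_def)
  \<comment> \<open>Clamping extends functions on the interval to bounded continuous functions on the line,
    which form a complete space.\<close>
  define cl where "cl t = max a (min b t)" for t :: real
  have cl: "cl t \<in> {a..b}" for t using ab by (auto simp: cl_def)
  have cl_id: "cl t = t" if "t \<in> {a..b}" for t using that by (auto simp: cl_def)
  have cl_cont: "continuous_on X cl" for X unfolding cl_def by (intro continuous_intros)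
  define f where "f y s = exp (L * s) *\<^sub>R mul (B s) (y s)" for y :: "real \<Rightarrow> 'b" and s
  define T0 where "T0 y t = exp (- L * t) *\<^sub>R (y0 + integral {a..t} (f y))" for y t
  have f_cont: "continuous_on {a..b} (f y)" if "continuous_on {a..b} y" for y
    unfolding f_def using B that by (intro continuous_intros continuous_on) auto
  have T0_cont: "continuous_on {a..b} (T0 y)" if "continuous_on {a..b} y" for y
    unfolding T0_def
    using integrable_continuous_real[OF f_cont[OF that]] 
    by (intro continuous_intros indefinite_integral_continuous_1)
  have bc: "\<exists>F. \<forall>t. apply_bcontfun F t = T0 (apply_bcontfun y) (cl t)" for y
  proof -
    have "continuous_on {a..b} (apply_bcontfun y)"
      using apply_bcontfun[of y] by (auto simp: bcontfun_def intro: continuous_on_subset)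
    note c = T0_cont[OF this]
    then have "bounded (T0 (apply_bcontfun y) ` {a..b})"
      by (intro compact_imp_bounded compact_continuous_image) auto
    then have "bounded (range (\<lambda>t. T0 (apply_bcontfun y) (cl t)))"
      by (rule bounded_subset) (use cl in auto)
    moreover have "continuous_on UNIV (\<lambda>t. T0 (apply_bcontfun y) (cl t))"
      by (rule continuous_on_compose2[OF c cl_cont]) (use cl in auto)
    ultimately have "(\<lambda>t. T0 (apply_bcontfun y) (cl t)) \<in> bcontfun"
      by (simp add: bcontfun_def)
    then show ?thesis by (metis Bcontfun_inverse)
  qed
  define T where "T y = (SOME F. \<forall>t. apply_bcontfun F t = T0 (apply_bcontfun y) (cl t))" for y
  have T: "apply_bcontfun (T y) t = T0 (apply_bcontfun y) (cl t)" for y t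
    unfolding T_def using someI_ex[OF bc[of y]] by blast
  have contr: "dist (T y) (T z) \<le> (1/2) * dist y z" for y z
  proof (rule dist_bound)
    fix t0
    define t where "t = cl t0"
    have t: "t \<in> {a..b}" using cl by (simp add: t_def)
    have c: "continuous_on {a..t} (f (apply_bcontfun y))" for y
      by (rule continuous_on_subset[OF f_cont])
        (use apply_bcontfun[of y] t in \<open>auto simp: bcontfun_def intro: continuous_on_subset\<close>)
    have e: "((\<lambda>s. exp (L * s)) has_integral (exp (L * t) / L - exp (L * a) / L)) {a..t}"
      using t L by (intro fundamental_theorem_of_calculus)
        (auto intro!: derivative_eq_intros simp flip: has_real_derivative_iff_has_vector_derivative)
    have "norm (integral {a..t} (\<lambda>s. f (apply_bcontfun y) s - f (apply_bcontfun z) s))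
        \<le> integral {a..t} (\<lambda>s. (C * dist y z) * exp (L * s))"
    proof (rule integral_norm_bound_integral)
      show "(\<lambda>s. f (apply_bcontfun y) s - f (apply_bcontfun z) s) integrable_on {a..t}"
        using c by (intro integrable_continuous_real continuous_intros)
      show "(\<lambda>s. (C * dist y z) * exp (L * s)) integrable_on {a..t}"
        by (intro integrable_continuous_real continuous_intros)
      fix s assume s: "s \<in> {a..t}"
      have "norm (f (apply_bcontfun y) s - f (apply_bcontfun z) s)
          = exp (L * s) * norm (mul (B s) (apply_bcontfun y s - apply_bcontfun z s))"
        by (simp add: f_def diff_right flip: scaleR_diff_right)
      also have "\<dots> \<le> exp (L * s) * (C * norm (apply_bcontfun y s - apply_bcontfun z s))"
        using s t prod_le by (intro mult_left_mono) auto
      also have "\<dots> \<le> exp (L * s) * (C * dist y z)"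
        using C dist_bounded[of y s z] by (intro mult_left_mono) (auto simp: dist_norm)
      finally show "norm (f (apply_bcontfun y) s - f (apply_bcontfun z) s) \<le> (C * dist y z) * exp (L * s)"
        by (simp add: mult_ac)
    qed
    also have "\<dots> = (C * dist y z) * (exp (L * t) / L - exp (L * a) / L)"
      using e by (simp add: integral_unique)
    also have "\<dots> \<le> (C * dist y z) * (exp (L * t) / L)"
      using C L by (intro mult_left_mono) auto
    also have "\<dots> = exp (L * t) * ((1/2) * dist y z)"
      using C by (simp add: L_def)
    finally have I: "norm (integral {a..t} (\<lambda>s. f (apply_bcontfun y) s - f (apply_bcontfun z) s))
        \<le> exp (L * t) * ((1/2) * dist y z)" .
    have "dist (apply_bcontfun (T y) t0) (apply_bcontfun (T z) t0)
        = exp (- L * t) * norm (integral {a..t} (\<lambda>s. f (apply_bcontfun y) s - f (apply_bcontfun z) s))"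
      using c by (simp add: T T0_def dist_norm integral_diff integrable_continuous_real
          flip: t_def scaleR_diff_right)
    also have "\<dots> \<le> exp (- L * t) * (exp (L * t) * ((1/2) * dist y z))"
      using I by (intro mult_left_mono) auto
    also have "\<dots> = (1/2) * dist y z" by (simp add: exp_minus field_simps)
    finally show "dist (apply_bcontfun (T y) t0) (apply_bcontfun (T z) t0) \<le> (1/2) * dist y z" .
  qed
  obtain w where w: "T w = w"
    using banach_fix_type[of "1/2" T] contr by auto
  define w0 where "w0 = apply_bcontfun w"
  have w0: "exp (L * t) *\<^sub>R w0 t = y0 + integral {a..t} (f w0)" if "t \<in> {a..b}" for t
    using T[of w t] w cl_id[OF that] by (simp add: T0_def exp_minus flip: w0_def)
  define y where "y t = exp (L * t) *\<^sub>R w0 t" for t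
  have fy: "f w0 = (\<lambda>s. mul (B s) (y s))" by (simp add: fun_eq_iff f_def y_def scaleR_right)
  have "continuous_on {a..b} w0"
    using apply_bcontfun[of w] by (auto simp: bcontfun_def w0_def intro: continuous_on_subset)
  then have c: "continuous_on {a..b} (\<lambda>s. mul (B s) (y s))"
    using f_cont unfolding fy[symmetric] by blast
  have "(y has_vector_derivative mul (B t) (y t)) (at t within {a..b})" if t: "t \<in> {a..b}" for t
  proof -
    have "((\<lambda>t. y0 + integral {a..t} (\<lambda>s. mul (B s) (y s)))
        has_vector_derivative mul (B t) (y t)) (at t within {a..b})"
      using integral_has_vector_derivative[OF c t] by (auto intro: derivative_eq_intros)
    then show ?thesis
      by (rule has_vector_derivative_transform[OF t, rotated]) (simp add: w0 y_def fy)
  qed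
  moreover have "y a = y0" using w0[of a] ab by (simp add: y_def)
  ultimately show ?thesis using that by blast
qed


section \<open>The group inside its ambient matrix algebra\<close>

text \<open>
  Multiplication is bilinear and inversion is the restriction of a linear map, the conjugate
  transpose.  The product rule can thus be applied to \<open>G\<close>-valued functions without charts of \<open>G\<close>.
\<close>

lemma bounded_bilinear_gmul: "bounded_bilinear gmul"
proof -
  have "bilinear gmul"
    by (auto simp: bilinear_def linear_iff gmul_def matrix_matrix_mult_def vec_eq_iff sum_2
        algebra_simps forall_2)
  then show ?thesis by (simp add: bilinear_conv_bounded_bilinear)
qed

interpretation gmul: bounded_bilinear gmul
  by (rule bounded_bilinear_gmul)

lemma bounded_linear_ginv: "bounded_linear ginv"
proof -
  have "linear ginv"
    by (auto simp: linear_iff ginv_def adjoint_mat_def vec_eq_iff)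
  then show ?thesis by (simp add: linear_conv_bounded_linear)
qed

lemma ginv_ginv [simp]: "ginv (ginv g) = g"
  by (simp add: ginv_def adjoint_mat_def vec_eq_iff prod_eq_iff)

lemma ginv_gmul: "ginv (gmul g h) = gmul (ginv h) (ginv g)"
  by (simp add: ginv_def gmul_def adjoint_mat_def vec_eq_iff matrix_matrix_mult_def sum_2
      algebra_simps)

lemma gmul_gone_right [simp]: "gmul g gone = g"
  by (simp add: gmul_def gone_def)

lemma gmul_gone_left [simp]: "gmul gone g = g"
  by (rule gone_simps)

lemma gmul_inv_cancel:
  assumes "g \<in> G"
  shows "gmul (ginv g) (gmul g h) = h" "gmul g (gmul (ginv g) h) = h"
    "gmul (gmul h g) (ginv g) = h" "gmul (gmul h (ginv g)) g = h"
  by (simp_all add: gmul_ginv[OF assms] flip: gmul_assoc)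
    (simp_all add: gmul_ginv[OF assms] gmul_assoc)

lemma cmod_eq_1_iff: "cmod z = 1 \<longleftrightarrow> cnj z * z = 1"
proof -
  have "cnj z * z = complex_of_real ((cmod z)\<^sup>2)"
    by (simp only: complex_norm_square mult.commute)
  then have "cnj z * z = 1 \<longleftrightarrow> (cmod z)\<^sup>2 = 1" by (simp only: of_real_eq_1_iff)
  then show ?thesis using norm_ge_zero[of z] by (auto simp: power2_eq_1_iff)
qed

lemma G_iff: "g \<in> G \<longleftrightarrow> gmul (ginv g) g = gone \<and> det (fst g) = 1"
  by (cases g) (auto simp: G_def SU2_def U1_iff cmod_eq_1_iff gmul_def ginv_def gone_def)

lemma gone_in_G: "gone \<in> G"
  by (simp add: G_iff gone_def ginv_def gmul_def adjoint_mat_def mat_def vec_eq_iff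
      matrix_matrix_mult_def sum_2 forall_2 det_2)

text \<open>
  As \<open>B\<close> is skew-adjoint, \<open>g\<^sup>* g\<close> is constant along a solution of \<open>g' = - B g\<close>; as \<open>B\<close> is
  traceless, so is the determinant.
\<close>

lemma ode_stays_in_G:
  assumes g: "\<And>t. t \<in> {a..b} \<Longrightarrow> (g has_vector_derivative gmul (- B t) (g t)) (at t within {a..b})"
    and B: "\<And>t. t \<in> {a..b} \<Longrightarrow> B t \<in> lie_G" and a: "g a \<in> G" and t: "t \<in> {a..b}"
  shows "g t \<in> G"
proof -
  have const: "f t = f a" if 0: "\<And>s. s \<in> {a..b} \<Longrightarrow> (f has_vector_derivative 0) (at s within {a..b})"
    for f :: "real \<Rightarrow> 'x::real_normed_vector"
  proof -
    obtain c where c: "\<And>s. s \<in> {a..b} \<Longrightarrow> f s = c"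
      using has_vector_derivative_zero_constant[OF convex_real_interval(5) 0] by metis
    show ?thesis using t c[of t] c[of a] by auto
  qed
  have "gmul (ginv (g t)) (g t) = gmul (ginv (g a)) (g a)"
  proof (rule const)
    fix s assume s: "s \<in> {a..b}"
    have B': "ginv (B s) = - B s" using B[OF s] by (auto simp: lie_G_def ginv_def)
    have "((\<lambda>t. gmul (ginv (g t)) (g t)) has_vector_derivative
        gmul (ginv (g s)) (gmul (- B s) (g s)) + gmul (ginv (gmul (- B s) (g s))) (g s)) (at s within {a..b})"
      by (intro gmul.has_vector_derivative bounded_linear.has_vector_derivative[OF bounded_linear_ginv] g s)
    moreover have "gmul (ginv (g s)) (gmul (- B s) (g s)) + gmul (ginv (gmul (- B s) (g s))) (g s) = 0"
      by (simp add: ginv_gmul linear_neg[OF bounded_linear.linear[OF bounded_linear_ginv]] B'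
          gmul.minus_right gmul.minus_left gmul_assoc)
    ultimately show "((\<lambda>t. gmul (ginv (g t)) (g t)) has_vector_derivative 0) (at s within {a..b})"
      by simp
  qed
  moreover have "det (fst (g t)) = det (fst (g a))"
  proof (rule const)
    fix s assume s: "s \<in> {a..b}"
    have e: "((\<lambda>t. fst (g t) $ i $ j) has_vector_derivative
        fst (gmul (- B s) (g s)) $ i $ j) (at s within {a..b})" for i j
      using g[OF s]
      by (intro bounded_linear.has_vector_derivative[OF bounded_linear_vec_nth]
        bounded_linear.has_vector_derivative[OF bounded_linear_fst]) 
    have tr: "fst (B s) $ 2 $ 2 = - fst (B s) $ 1 $ 1"
      using B[OF s] by (auto simp: lie_G_def trace_def sum_2 eq_neg_iff_add_eq_0 add.commute)
    have "((\<lambda>t. det (fst (g t))) has_vector_derivative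
        (fst (g s) $ 1 $ 1 * fst (gmul (- B s) (g s)) $ 2 $ 2
         + fst (gmul (- B s) (g s)) $ 1 $ 1 * fst (g s) $ 2 $ 2)
        - (fst (g s) $ 1 $ 2 * fst (gmul (- B s) (g s)) $ 2 $ 1
         + fst (gmul (- B s) (g s)) $ 1 $ 2 * fst (g s) $ 2 $ 1)) (at s within {a..b})"
      unfolding det_2
      by (rule has_vector_derivative_diff[OF has_vector_derivative_mult[OF e e]
            has_vector_derivative_mult[OF e e]])
    then show "((\<lambda>t. det (fst (g t))) has_vector_derivative 0) (at s within {a..b})"
      by (simp add: gmul_def matrix_matrix_mult_def sum_2 tr algebra_simps)
  qed
  ultimately show ?thesis using a by (simp add: G_iff)
qed

section \<open>Charts\<close>

lemma chart_simps:
  assumes "smooth_atlas P" "c \<in> P"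
  shows "open (dom c)" "p \<in> dom c \<Longrightarrow> coord_inv c (coord c p) = p"
    "y \<in> coord c ` dom c \<Longrightarrow> coord c (coord_inv c y) = y"
    "continuous_on (dom c) (coord c)" "continuous_on (coord c ` dom c) (coord_inv c)"
  using assms by (auto simp: smooth_atlas_def is_chart_def homeomorphism_def)

lemma chart_open_image:
  assumes "smooth_atlas P" "c \<in> P" "open U"
  shows "open (coord c ` (dom c \<inter> U))"
proof -
  have "coord c ` (dom c \<inter> U) = coord_inv c -` U \<inter> coord c ` dom c"
    using chart_simps[OF assms(1,2)] by force
  moreover have "open (coord c ` dom c)" using assms by (auto simp: smooth_atlas_def is_chart_def)
  ultimately show ?thesis
    using chart_simps(5)[OF assms(1,2)] assms(3) continuous_on_open_vimage by metis
qed

lemma chart_at_in: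
  assumes "smooth_atlas P"
  shows "chart_at P p \<in> P" "p \<in> dom (chart_at P p)"
proof -
  have "\<exists>c. c \<in> P \<and> p \<in> dom c" using assms unfolding smooth_atlas_def by (metis UNIV_I UN_iff)
  from someI_ex[OF this] show "chart_at P p \<in> P" "p \<in> dom (chart_at P p)"
    by (auto simp: chart_at_def)
qed

lemma smooth_fun_derivative:
  assumes "smooth_atlas P" "smooth_fun P D F" "c \<in> P" "p \<in> dom c" "open D" "p \<in> D"
  shows "((F \<circ> coord_inv c) has_derivative frechet_derivative (F \<circ> coord_inv c) (at (coord c p))) (at (coord c p))"
  using assms by (intro smooth_on_open_derivative[OF _ chart_open_image]) (auto simp: smooth_fun_def)

lemma smooth_fun_continuous:
  assumes "smooth_atlas P" "smooth_fun P D F" "c \<in> P" "open D"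
  shows "continuous_on (dom c \<inter> D) F"
proof -
  have "continuous_on (coord c ` (dom c \<inter> D)) (F \<circ> coord_inv c)"
    using assms by (intro smooth_on_open_continuous chart_open_image) (auto simp: smooth_fun_def)
  then have "continuous_on (dom c \<inter> D) (\<lambda>p. (F \<circ> coord_inv c) (coord c p))"
    by (rule continuous_on_compose2)
      (use chart_simps(4)[OF assms(1,3)] in \<open>auto intro: continuous_on_subset\<close>)
  then show ?thesis
    by (rule continuous_on_eq) (use chart_simps(2)[OF assms(1,3)] in auto)
qed

lemma transition_derivative:
  assumes "smooth_atlas P" "c \<in> P" "c' \<in> P" "p \<in> dom c" "p \<in> dom c'"
  shows "(transition c c' has_derivative frechet_derivative (transition c c') (at (coord c p))) (at (coord c p))"
  using assms by (intro smooth_on_open_derivative[OF _ chart_open_image[OF assms(1,2), of "dom c'"]])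
    (auto simp: smooth_atlas_def is_chart_def)

section \<open>Velocities, tangent vectors and connection forms\<close>

text \<open>
  The chain rule in a chart; that differentiation along a curve depends only on its velocity is the
  reason why velocities transform as tangent vectors (\<open>velocity_tangent\<close> below).
\<close>

lemma velocity_chain:
  assumes P: "smooth_atlas P" and c: "c \<in> P" "\<gamma> t \<in> dom c" and t: "t \<in> S"
    and \<gamma>: "continuous (at t within S) \<gamma>" "(coord c \<circ> \<gamma>) differentiable (at t within S)"
    and F: "(F \<circ> coord_inv c) differentiable (at (coord c (\<gamma> t)))"
  shows "((F \<circ> \<gamma>) has_vector_derivative
    frechet_derivative (F \<circ> coord_inv c) (at (coord c (\<gamma> t))) (velocity P S \<gamma> t c)) (at t within S)"
proof -
  have v: "velocity P S \<gamma> t c = vector_derivative (coord c \<circ> \<gamma>) (at t within S)"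
    using c by (simp add: velocity_def)
  have "((F \<circ> coord_inv c) \<circ> (coord c \<circ> \<gamma>) has_vector_derivative
      frechet_derivative (F \<circ> coord_inv c) (at (coord c (\<gamma> t))) (velocity P S \<gamma> t c)) (at t within S)"
    unfolding v
  proof (rule vector_derivative_diff_chain_within)
    show "(coord c \<circ> \<gamma> has_vector_derivative vector_derivative (coord c \<circ> \<gamma>) (at t within S))
        (at t within S)"
      using \<gamma>(2) vector_derivative_works by blast
    show "(F \<circ> coord_inv c has_derivative frechet_derivative (F \<circ> coord_inv c) (at (coord c (\<gamma> t))))
        (at ((coord c \<circ> \<gamma>) t) within (coord c \<circ> \<gamma>) ` S)"
      using F by (auto simp only: frechet_derivative_works o_def intro: has_derivative_at_withinI)
  qed
  moreover have "\<forall>\<^sub>F s in at t within S. \<gamma> s \<in> dom c"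
    using \<gamma>(1) c chart_simps(1)[OF P c(1)] 
    by (auto simp: continuous_within intro: topological_tendstoD)
  then have "\<forall>\<^sub>F s in at t within S. ((F \<circ> coord_inv c) \<circ> (coord c \<circ> \<gamma>)) s = (F \<circ> \<gamma>) s"
    by eventually_elim (use chart_simps(2)[OF P c(1)] in auto)
  ultimately show ?thesis
    unfolding has_vector_derivative_def
    by (rule has_derivative_transform_eventually) (use chart_simps(2)[OF P c(1)] c t in auto)
qed

lemma differential_velocity:
  assumes "smooth_atlas P" "t \<in> S" "continuous (at t within S) \<gamma>"
    and "\<And>c. c \<in> P \<Longrightarrow> \<gamma> t \<in> dom c \<Longrightarrow> (coord c \<circ> \<gamma>) differentiable (at t within S)"
    and "\<And>c. c \<in> P \<Longrightarrow> \<gamma> t \<in> dom c \<Longrightarrow> (F \<circ> coord_inv c) differentiable (at (coord c (\<gamma> t)))"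
  shows "((F \<circ> \<gamma>) has_vector_derivative differential P F (\<gamma> t) (velocity P S \<gamma> t)) (at t within S)"
  unfolding differential_def Let_def
  using assms chart_at_in[OF assms(1), of "\<gamma> t"] by (intro velocity_chain) auto

lemma velocity_tangent:
  assumes P: "smooth_atlas P" and t: "t \<in> S" "at t within S \<noteq> bot"
    and \<gamma>: "continuous (at t within S) \<gamma>"
      "\<And>c. c \<in> P \<Longrightarrow> \<gamma> t \<in> dom c \<Longrightarrow> (coord c \<circ> \<gamma>) differentiable (at t within S)"
  shows "velocity P S \<gamma> t \<in> tangent_space P (\<gamma> t)"
proof -
  have "velocity P S \<gamma> t c' =
      frechet_derivative (transition c c') (at (coord c (\<gamma> t))) (velocity P S \<gamma> t c)"
    if c: "c \<in> P" "c' \<in> P" "\<gamma> t \<in> dom c" "\<gamma> t \<in> dom c'" for c c'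
  proof -
    have "((coord c' \<circ> \<gamma>) has_vector_derivative
        frechet_derivative (transition c c') (at (coord c (\<gamma> t))) (velocity P S \<gamma> t c)) (at t within S)"
      unfolding transition_def
      using P c t \<gamma> transition_derivative[OF P c]
      by (intro velocity_chain) (auto simp: transition_def intro: differentiableI)
    then show ?thesis
      using c vector_derivative_within[OF t(2)] by (auto simp: velocity_def)
  qed
  moreover have "velocity P S \<gamma> t c = 0" if "c \<notin> P \<or> \<gamma> t \<notin> dom c" for c
    using that by (auto simp: velocity_def)
  ultimately show ?thesis unfolding tangent_space_def by blast
qed

text \<open>
  The transformation law holds by the cocycle property of the transition maps and the chain rule.
\<close>

lemma coord_vector_tangent:
  assumes P: "smooth_atlas P" and c: "c \<in> P" "p \<in> dom c"
  shows "coord_vector P c u p \<in> tangent_space P p"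
proof -
  have *: "coord_vector P c u p c2 =
      frechet_derivative (transition c1 c2) (at (coord c1 p)) (coord_vector P c u p c1)"
    if c12: "c1 \<in> P" "c2 \<in> P" "p \<in> dom c1" "p \<in> dom c2" for c1 c2
  proof -
    have "(transition c1 c2 has_derivative frechet_derivative (transition c1 c2) (at (coord c1 p)))
        (at (transition c c1 (coord c p)))"
      using transition_derivative[OF P c12] chart_simps(2)[OF P c] by (simp add: transition_def)
    from diff_chain_at[OF transition_derivative[OF P c(1) c12(1) c(2) c12(3)] this]
    have "(transition c1 c2 \<circ> transition c c1 has_derivative
        frechet_derivative (transition c1 c2) (at (coord c1 p)) \<circ>
        frechet_derivative (transition c c1) (at (coord c p))) (at (coord c p))" .
    then have "(transition c c2 has_derivative
        frechet_derivative (transition c1 c2) (at (coord c1 p)) \<circ>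
        frechet_derivative (transition c c1) (at (coord c p))) (at (coord c p))"
      by (rule has_derivative_transform_within_open[OF _ chart_open_image[OF P c(1) chart_simps(1)[OF P c12(1)]]])
        (use c c12 chart_simps(2)[OF P c(1)] chart_simps(2)[OF P c12(1)] in \<open>auto simp: transition_def\<close>)
    from fun_cong[OF frechet_derivative_at[OF this], of u] show ?thesis
      using c12 by (simp add: coord_vector_def)
  qed
  show ?thesis
    unfolding tangent_space_def
    by (intro CollectI conjI ballI allI impI, rule *) (auto simp: coord_vector_def)
qed

lemma tangent_eq_coord_vector:
  assumes "X \<in> tangent_space P p" "c \<in> P" "p \<in> dom c"
  shows "coord_vector P c (X c) p = X"
proof
  fix c'
  show "coord_vector P c (X c) p c' = X c'"
  proof (cases "c' \<in> P \<and> p \<in> dom c'")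
    case True
    then have "X c' = frechet_derivative (transition c c') (at (coord c p)) (X c)"
      using assms unfolding tangent_space_def by blast
    then show ?thesis using True by (simp add: coord_vector_def)
  next
    case False
    then have "X c' = 0" using assms unfolding tangent_space_def by blast
    then show ?thesis using False by (auto simp: coord_vector_def)
  qed
qed

text \<open>
  A connection form is assumed to be linear on tangent spaces and smooth on coordinate vector fields;
  this expansion reduces its values on velocities to those fields.
\<close>

lemma connection_coordinates:
  assumes P: "smooth_atlas P" and A: "connection_form P act A"
    and X: "X \<in> tangent_space P p" and c: "c \<in> P" "p \<in> dom c"
  shows "A p X = (\<Sum>b\<in>Basis. (X c \<bullet> b) *\<^sub>R A p (coord_vector P c b p))"
proof -
  have lin: "linear (frechet_derivative (transition c c') (at (coord c p)))"
    if "c' \<in> P" "p \<in> dom c'" for c'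
    using transition_derivative[OF P c(1) that(1) c(2) that(2)] by (rule has_derivative_linear)
  have add: "coord_vector P c (u + w) p = (\<lambda>c'. coord_vector P c u p c' + coord_vector P c w p c')" for u w
    using lin by (auto simp: coord_vector_def fun_eq_iff linear_add)
  have scale: "coord_vector P c (r *\<^sub>R u) p = (\<lambda>c'. r *\<^sub>R coord_vector P c u p c')" for u r
    using lin by (auto simp: coord_vector_def fun_eq_iff linear_cmul)
  have "linear (\<lambda>u. A p (coord_vector P c u p))"
    using A coord_vector_tangent[OF P c]
    by (auto simp: linear_iff add scale connection_form_def)
  from linear_basis_expansion[OF this, of "X c"] show ?thesis
    by (simp only: tangent_eq_coord_vector[OF X c])
qed


section \<open>Covariantly constant fields\<close>

text \<open>
  The values range over the whole ambient algebra instead of \<open>G\<close>, so that linear combinations of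
  covariantly constant fields can be formed.
\<close>

definition covariantly_constant ::
  "('p::topological_space, 'f::euclidean_space) chart set \<Rightarrow> ('p \<Rightarrow> amb \<Rightarrow> 'p) \<Rightarrow>
   ('p \<Rightarrow> ('p, 'f) tangent \<Rightarrow> amb) \<Rightarrow> ('p \<Rightarrow> amb) \<Rightarrow> bool" where
  "covariantly_constant P act A V \<longleftrightarrow> smooth_fun P UNIV V \<and>
     (\<forall>p. \<forall>g\<in>G. V (act p g) = gmul (gmul (ginv g) (V p)) g) \<and>
     (\<forall>p. \<forall>X\<in>tangent_space P p. differential P V p X = gmul (V p) (A p X) - gmul (A p X) (V p))"

lemma differential_eq:
  assumes "((F \<circ> coord_inv (chart_at P p)) has_derivative F') (at (coord (chart_at P p) p))"
  shows "differential P F p X = F' (X (chart_at P p))"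
  using frechet_derivative_at[OF assms] by (simp add: differential_def Let_def)

lemma smooth_fun_has_differential:
  assumes "smooth_atlas P" "smooth_fun P UNIV F"
  obtains F' where "((F \<circ> coord_inv (chart_at P p)) has_derivative F') (at (coord (chart_at P p) p))"
    "\<And>X. differential P F p X = F' (X (chart_at P p))"
  using smooth_fun_derivative[OF assms chart_at_in[OF assms(1)] open_UNIV UNIV_I] differential_eq
  by metis

lemma differential_gmul:
  assumes "smooth_atlas P" "smooth_fun P UNIV V" "smooth_fun P UNIV W"
  shows "differential P (\<lambda>p. gmul (V p) (W p)) p X =
    gmul (V p) (differential P W p X) + gmul (differential P V p X) (W p)"
proof -
  obtain V' where V: "((V \<circ> coord_inv (chart_at P p)) has_derivative V') (at (coord (chart_at P p) p))"
    "differential P V p X = V' (X (chart_at P p))"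
    using smooth_fun_has_differential[OF assms(1,2), of p] by blast
  obtain W' where W: "((W \<circ> coord_inv (chart_at P p)) has_derivative W') (at (coord (chart_at P p) p))"
    "differential P W p X = W' (X (chart_at P p))"
    using smooth_fun_has_differential[OF assms(1,3), of p] by blast
  have "((\<lambda>p. gmul (V p) (W p)) \<circ> coord_inv (chart_at P p) has_derivative
      (\<lambda>u. gmul (V p) (W' u) + gmul (V' u) (W p))) (at (coord (chart_at P p) p))"
    using gmul.FDERIV[OF V(1) W(1)] chart_simps(2)[OF assms(1) chart_at_in[OF assms(1)]]
    by (simp add: o_def)
  from differential_eq[OF this, of X] show ?thesis by (simp add: V(2) W(2))
qed

lemma differential_add:
  assumes "smooth_atlas P" "smooth_fun P UNIV V" "smooth_fun P UNIV W"
  shows "differential P (\<lambda>p. V p + W p) p X = differential P V p X + differential P W p X"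
proof -
  obtain V' where V: "((V \<circ> coord_inv (chart_at P p)) has_derivative V') (at (coord (chart_at P p) p))"
    "differential P V p X = V' (X (chart_at P p))"
    using smooth_fun_has_differential[OF assms(1,2), of p] by blast
  obtain W' where W: "((W \<circ> coord_inv (chart_at P p)) has_derivative W') (at (coord (chart_at P p) p))"
    "differential P W p X = W' (X (chart_at P p))"
    using smooth_fun_has_differential[OF assms(1,3), of p] by blast
  have "((\<lambda>p. V p + W p) \<circ> coord_inv (chart_at P p) has_derivative (\<lambda>u. V' u + W' u))
      (at (coord (chart_at P p) p))"
    using has_derivative_add[OF V(1) W(1)] by (simp add: o_def)
  from differential_eq[OF this, of X] show ?thesis by (simp add: V(2) W(2))
qed

lemma differential_ginv:
  assumes "smooth_atlas P" "smooth_fun P UNIV V"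
  shows "differential P (\<lambda>p. ginv (V p)) p X = ginv (differential P V p X)"
proof -
  obtain V' where V: "((V \<circ> coord_inv (chart_at P p)) has_derivative V') (at (coord (chart_at P p) p))"
    "differential P V p X = V' (X (chart_at P p))"
    using smooth_fun_has_differential[OF assms, of p] by blast
  have "((\<lambda>p. ginv (V p)) \<circ> coord_inv (chart_at P p) has_derivative (\<lambda>u. ginv (V' u)))
      (at (coord (chart_at P p) p))"
    using bounded_linear.has_derivative[OF bounded_linear_ginv V(1)] by (simp add: o_def)
  from differential_eq[OF this, of X] show ?thesis by (simp add: V(2))
qed

lemma differential_const: "differential P (\<lambda>p. c) p X = 0"
  using differential_eq[where F = "\<lambda>p. c" and F' = "\<lambda>u. 0"] by (simp add: o_def)

lemma smooth_fun_const: "smooth_fun P D (\<lambda>p. c)"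
  by (simp add: smooth_fun_def o_def smooth_on_const)

lemma smooth_fun_add: "smooth_fun P D V \<Longrightarrow> smooth_fun P D W \<Longrightarrow> smooth_fun P D (\<lambda>p. V p + W p)"
  using smooth_on_add by (fastforce simp: smooth_fun_def o_def)

lemma smooth_fun_gmul:
  "smooth_fun P D V \<Longrightarrow> smooth_fun P D W \<Longrightarrow> smooth_fun P D (\<lambda>p. gmul (V p) (W p))"
  using smooth_on_bilinear[OF bounded_bilinear_gmul] by (fastforce simp: smooth_fun_def o_def)

lemma smooth_fun_ginv: "smooth_fun P D V \<Longrightarrow> smooth_fun P D (\<lambda>p. ginv (V p))"
  using smooth_on_linear[OF bounded_linear_ginv] by (fastforce simp: smooth_fun_def o_def)

text \<open>
  Differentiating \<open>l\<^sup>-\<^sup>1 l = 1\<close> gives \<open>l (dl\<^sup>-\<^sup>1) l = - dl\<close>.  Multiplying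
  \<open>Ad l A + l dl\<^sup>-\<^sup>1 = A\<close> by \<open>l\<close> from the right therefore turns it into an equation that is linear
  in \<open>l\<close>.
\<close>

lemma gauge_connection_fixed_iff:
  assumes P: "smooth_atlas P" and l: "smooth_fun P UNIV l" "range l \<subseteq> G"
  shows "gauge_connection P l A p X = A p X \<longleftrightarrow>
    differential P l p X = gmul (l p) (A p X) - gmul (A p X) (l p)"
proof -
  define D where "D = differential P l p X"
  have lG: "l q \<in> G" for q using l(2) by auto
  have "(\<lambda>q. gmul (ginv (l q)) (l q)) = (\<lambda>q. gone)" using lG gmul_ginv by auto
  then have "differential P (\<lambda>q. gmul (ginv (l q)) (l q)) p X = 0" by (simp add: differential_const)
  then have "gmul (ginv (l p)) D + gmul (ginv D) (l p) = 0"
    by (simp add: differential_gmul differential_ginv P l smooth_fun_ginv D_def)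
  then have "gmul (ginv D) (l p) = - gmul (ginv (l p)) D" by (simp add: eq_neg_iff_add_eq_0 add.commute)
  then have D: "gmul (gmul (l p) (ginv D)) (l p) = - D"
    by (simp add: gmul_assoc gmul.minus_right gmul_inv_cancel lG)
  have "gauge_connection P l A p X = A p X \<longleftrightarrow>
      gmul (gauge_connection P l A p X) (l p) = gmul (A p X) (l p)"
    by (metis gmul_inv_cancel(3) lG)
  also have "gmul (gauge_connection P l A p X) (l p) = gmul (l p) (A p X) - D"
    by (simp add: gauge_connection_def Ad_def differential_ginv[OF P l(1)] gmul.add_left D
        gmul_inv_cancel lG flip: D_def)
  finally show ?thesis unfolding D_def by (auto simp: algebra_simps)
qed

lemma Gau_A_iff:
  assumes P: "smooth_atlas P"
  shows "l \<in> Gau_A P act A \<longleftrightarrow> covariantly_constant P act A l \<and> range l \<subseteq> G"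
proof (cases "smooth_fun P UNIV l \<and> range l \<subseteq> G")
  case True
  then have "\<And>A p X. gauge_connection P l A p X = A p X \<longleftrightarrow>
    differential P l p X = gmul (l p) (A p X) - gmul (A p X) (l p)"
    using gauge_connection_fixed_iff[OF P] by blast
  then show ?thesis using True
    unfolding Gau_A_def Gau_def covariantly_constant_def mem_Collect_eq by blast
qed (auto simp: Gau_A_def Gau_def covariantly_constant_def)

lemma covariantly_constant_central:
  assumes "\<And>g. gmul c g = gmul g c"
  shows "covariantly_constant P act A (\<lambda>p. c)"
proof -
  have "gmul (gmul (ginv g) c) g = c" if "g \<in> G" for g
    using that by (simp add: gmul_assoc assms gmul_inv_cancel)
  then show ?thesis
    by (simp add: covariantly_constant_def smooth_fun_const differential_const assms)
qed

lemma covariantly_constant_add: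
  assumes P: "smooth_atlas P" and V: "covariantly_constant P act A V" and W: "covariantly_constant P act A W"
  shows "covariantly_constant P act A (\<lambda>p. V p + W p)"
proof -
  have sm: "smooth_fun P UNIV V" "smooth_fun P UNIV W"
    using V W by (auto simp: covariantly_constant_def)
  show ?thesis
    using V W
    by (simp add: covariantly_constant_def smooth_fun_add differential_add[OF P sm] gmul.add_left gmul.add_right)
qed

text \<open>Commutation with \<open>A\<close> is a derivation of the algebra, as is the differential.\<close>

lemma covariantly_constant_gmul:
  assumes P: "smooth_atlas P" and V: "covariantly_constant P act A V" and W: "covariantly_constant P act A W"
  shows "covariantly_constant P act A (\<lambda>p. gmul (V p) (W p))"
  unfolding covariantly_constant_def
proof (intro conjI allI ballI)
  have sm: "smooth_fun P UNIV V" "smooth_fun P UNIV W" using V W by (auto simp: covariantly_constant_def)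
  then show "smooth_fun P UNIV (\<lambda>p. gmul (V p) (W p))" by (rule smooth_fun_gmul)
  show "gmul (V (act p g)) (W (act p g)) = gmul (gmul (ginv g) (gmul (V p) (W p))) g" if "g \<in> G" for p g
    using V W that by (simp add: covariantly_constant_def gmul_assoc gmul_inv_cancel)
  show "differential P (\<lambda>p. gmul (V p) (W p)) p X =
      gmul (gmul (V p) (W p)) (A p X) - gmul (A p X) (gmul (V p) (W p))"
    if "X \<in> tangent_space P p" for p X
    using V W that
    by (simp add: covariantly_constant_def differential_gmul[OF P sm] gmul_assoc gmul.diff_left gmul.diff_right)
qed

lemma covariantly_constant_scaleR:
  assumes P: "smooth_atlas P" and V: "covariantly_constant P act A V"
  shows "covariantly_constant P act A (\<lambda>p. r *\<^sub>R V p)"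
proof -
  have "covariantly_constant P act A (\<lambda>p. r *\<^sub>R gone)"
    by (rule covariantly_constant_central) (simp add: gmul.scaleR_left gmul.scaleR_right)
  from covariantly_constant_gmul[OF P this V] show ?thesis by (simp add: gmul.scaleR_left)
qed

text \<open>
  Along a horizontal curve \<open>A\<close> vanishes on the velocity, so the equation \<open>dV = V A - A V\<close> says that
  \<open>V\<close> has derivative zero.
\<close>

lemma covariantly_constant_horizontal:
  assumes P: "smooth_atlas P" and V: "covariantly_constant P act A V" and \<gamma>: "horizontal_curve P A \<gamma>"
  shows "V (\<gamma> 1) = V (\<gamma> 0)"
proof -
  have "(V \<circ> \<gamma> has_vector_derivative 0) (at t within {0..1})" if t: "t \<in> {0..1}" for t
  proof -
    have c: "continuous (at t within {0..1}) \<gamma>"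
      using \<gamma> t by (auto simp: horizontal_curve_def C1_curve_def continuous_on_eq_continuous_within)
    have d: "(coord c \<circ> \<gamma>) differentiable (at t within {0..1})" if "c \<in> P" "\<gamma> t \<in> dom c" for c
      using \<gamma> t that by (auto simp: horizontal_curve_def C1_curve_def Let_def)
    have "at t within {0..1} \<noteq> bot" using t by (simp add: trivial_limit_within)
    then have X: "velocity P {0..1} \<gamma> t \<in> tangent_space P (\<gamma> t)"
      by (intro velocity_tangent P t c d)
    have sm: "smooth_fun P UNIV V" using V by (simp add: covariantly_constant_def)
    have "(V \<circ> \<gamma> has_vector_derivative differential P V (\<gamma> t) (velocity P {0..1} \<gamma> t)) (at t within {0..1})"
      using smooth_fun_derivative[OF P sm _ _ open_UNIV UNIV_I]
      by (intro differential_velocity P t c d) (auto intro: differentiableI)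
    moreover have "differential P V (\<gamma> t) (velocity P {0..1} \<gamma> t) = 0"
      using V X \<gamma> t by (simp add: covariantly_constant_def horizontal_curve_def gmul.zero_left gmul.zero_right)
    ultimately show ?thesis by simp
  qed
  then obtain c where "\<And>t. t \<in> {0..1} \<Longrightarrow> (V \<circ> \<gamma>) t = c"
    using has_vector_derivative_zero_constant[OF convex_real_interval(5), of 0 1 "V \<circ> \<gamma>"] by blast
  from this[of 0] this[of 1] show ?thesis by simp
qed

lemma covariantly_constant_holonomy_bundle:
  assumes P: "smooth_atlas P" and V: "covariantly_constant P act A V" and p: "p \<in> holonomy_bundle P A p\<^sub>0"
  shows "V p = V p\<^sub>0"
proof -
  have "(\<lambda>q r. \<exists>\<gamma>. horizontal_curve P A \<gamma> \<and> \<gamma> 0 = q \<and> \<gamma> 1 = r)\<^sup>*\<^sup>* p\<^sub>0 p"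
    using p by (simp add: holonomy_bundle_def)
  then show ?thesis
    by induction (use covariantly_constant_horizontal[OF P V] in auto)
qed


section \<open>Curves in manifolds\<close>

text \<open>
  In contrast to \<open>C1_curve\<close>, the parameter domain \<open>J\<close> is open and all derivatives are two-sided; curves
  on \<open>[0, 1]\<close> are obtained by restricting curves on a larger interval.
\<close>

definition C1_curve_on ::
  "('m::topological_space, 'e::euclidean_space) chart set \<Rightarrow> real set \<Rightarrow> (real \<Rightarrow> 'm) \<Rightarrow> bool" where
  "C1_curve_on M J \<gamma> \<longleftrightarrow> open J \<and> continuous_on J \<gamma> \<and>
     (\<forall>c\<in>M. (\<forall>t\<in>J \<inter> \<gamma> -` dom c. (coord c \<circ> \<gamma>) differentiable (at t)) \<and>
        continuous_on (J \<inter> \<gamma> -` dom c) (\<lambda>t. vector_derivative (coord c \<circ> \<gamma>) (at t)))"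

lemma C1_curve_on_continuous:
  "C1_curve_on M J \<gamma> \<Longrightarrow> t \<in> J \<Longrightarrow> continuous (at t) \<gamma>"
  by (metis C1_curve_on_def continuous_on_eq_continuous_at)

lemma C1_curve_on_differentiable:
  "C1_curve_on M J \<gamma> \<Longrightarrow> t \<in> J \<Longrightarrow> c \<in> M \<Longrightarrow> \<gamma> t \<in> dom c \<Longrightarrow> (coord c \<circ> \<gamma>) differentiable (at t)"
  by (simp add: C1_curve_on_def)

lemma C1_curve_on_tangent:
  assumes "smooth_atlas M" "C1_curve_on M J \<gamma>" "t \<in> J"
  shows "velocity M UNIV \<gamma> t \<in> tangent_space M (\<gamma> t)"
  using assms C1_curve_on_continuous C1_curve_on_differentiable
  by (intro velocity_tangent) auto

lemma velocity_cong:
  fixes P :: "('p, 'f::euclidean_space) chart set"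
  assumes "open J" "t \<in> J" "\<And>\<tau>. \<tau> \<in> J \<Longrightarrow> \<gamma> \<tau> = \<gamma>' \<tau>"
  shows "velocity P UNIV \<gamma> t = velocity P UNIV \<gamma>' t"
proof -
  have "((coord c \<circ> \<gamma>) has_vector_derivative v) (at t) \<longleftrightarrow> ((coord c \<circ> \<gamma>') has_vector_derivative v) (at t)"
    for c :: "('p, 'f) chart" and v
    using has_vector_derivative_transform_within_open[OF _ assms(1,2), of "coord c \<circ> \<gamma>" v "coord c \<circ> \<gamma>'"]
      has_vector_derivative_transform_within_open[OF _ assms(1,2), of "coord c \<circ> \<gamma>'" v "coord c \<circ> \<gamma>"]
      assms(3) by auto
  then have *: "vector_derivative (coord c \<circ> \<gamma>) (at t) = vector_derivative (coord c \<circ> \<gamma>') (at t)"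
    for c :: "('p, 'f) chart"
    unfolding vector_derivative_def by simp
  show ?thesis unfolding velocity_def assms(3)[OF assms(2)] * ..
qed

lemma C1_curve_on_velocity_within:
  assumes "C1_curve_on M J \<gamma>" "t \<in> J" "t \<in> {0..1}"
  shows "velocity M {0..1} \<gamma> t = velocity M UNIV \<gamma> t"
proof -
  have "vector_derivative (coord c \<circ> \<gamma>) (at t within {0..1}) = vector_derivative (coord c \<circ> \<gamma>) (at t)"
    if "c \<in> M" "\<gamma> t \<in> dom c" for c
    using C1_curve_on_differentiable[OF assms(1,2) that] assms(3)
    by (intro vector_derivative_at_within_ivl[where a = 0 and b = 1])
      (auto simp: vector_derivative_works)
  then show ?thesis by (auto simp: velocity_def fun_eq_iff)
qed

lemma C1_curve_on_imp_C1_curve: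
  assumes \<gamma>: "C1_curve_on M J \<gamma>" and J: "{0..1} \<subseteq> J"
  shows "C1_curve M \<gamma>"
  unfolding C1_curve_def Let_def
proof (intro conjI ballI)
  show "continuous_on {0..1} \<gamma>"
    using assms by (auto simp: C1_curve_on_def intro: continuous_on_subset)
  fix c assume c: "c \<in> M"
  show "(coord c \<circ> \<gamma>) differentiable (at t within {0..1})" if "t \<in> {0..1} \<inter> \<gamma> -` dom c" for t
    using C1_curve_on_differentiable[OF \<gamma> _ c, of t] that J
    by (simp add: differentiable_at_withinI subset_iff)
  have "continuous_on ({0..1} \<inter> \<gamma> -` dom c) (\<lambda>t. vector_derivative (coord c \<circ> \<gamma>) (at t))"
    using \<gamma> c J by (auto simp: C1_curve_on_def intro: continuous_on_subset)
  moreover have "vector_derivative (coord c \<circ> \<gamma>) (at t) = vector_derivative (coord c \<circ> \<gamma>) (at t within {0..1})"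
    if "t \<in> {0..1} \<inter> \<gamma> -` dom c" for t
    using fun_cong[OF C1_curve_on_velocity_within[OF \<gamma>, of t], of c] that J c
    by (auto simp: velocity_def)
  ultimately show "continuous_on ({0..1} \<inter> \<gamma> -` dom c) (\<lambda>t. vector_derivative (coord c \<circ> \<gamma>) (at t within {0..1}))"
    by (rule continuous_on_eq)
qed

text \<open>
  This is the continuity of the coefficient of the differential equation for horizontal lifts.
\<close>

lemma connection_along_curve_continuous:
  assumes P: "smooth_atlas P" and A: "connection_form P act A" and \<gamma>: "C1_curve_on P J \<gamma>"
  shows "continuous_on J (\<lambda>t. A (\<gamma> t) (velocity P UNIV \<gamma> t))"
proof (rule continuous_at_imp_continuous_on, rule ballI)
  fix t0 assume t0: "t0 \<in> J"
  obtain c where c: "c \<in> P" "\<gamma> t0 \<in> dom c" using chart_at_in[OF P] by blast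
  define I where "I = J \<inter> \<gamma> -` dom c"
  have \<gamma>I: "continuous_on I \<gamma>" "open J" "continuous_on J \<gamma>"
    using \<gamma> by (auto simp: C1_curve_on_def I_def intro: continuous_on_subset)
  have I: "open I" "t0 \<in> I"
    using continuous_open_preimage[OF \<gamma>I(3,2) chart_simps(1)[OF P c(1)]] c t0 by (auto simp: I_def)
  have v: "continuous_on I (\<lambda>t. velocity P UNIV \<gamma> t c)"
    by (rule continuous_on_eq[where f = "\<lambda>t. vector_derivative (coord c \<circ> \<gamma>) (at t)"])
      (use \<gamma> c in \<open>auto simp: C1_curve_on_def I_def velocity_def\<close>)
  have e: "continuous_on I (\<lambda>t. A (\<gamma> t) (coord_vector P c b (\<gamma> t)))" for b
  proof (rule continuous_on_compose2[OF _ \<gamma>I(1)])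
    have "smooth_fun P (dom c) (\<lambda>p. A p (coord_vector P c b p))"
      using A c by (simp add: connection_form_def)
    from smooth_fun_continuous[OF P this c(1) chart_simps(1)[OF P c(1)]]
    show "continuous_on (dom c) (\<lambda>p. A p (coord_vector P c b p))" by simp
  qed (auto simp: I_def)
  have "continuous_on I (\<lambda>t. \<Sum>b\<in>Basis. (velocity P UNIV \<gamma> t c \<bullet> b) *\<^sub>R A (\<gamma> t) (coord_vector P c b (\<gamma> t)))"
    by (intro continuous_intros v e)
  then have "continuous_on I (\<lambda>t. A (\<gamma> t) (velocity P UNIV \<gamma> t))"
  proof (rule continuous_on_eq)
    fix t assume "t \<in> I"
    then show "(\<Sum>b\<in>Basis. (velocity P UNIV \<gamma> t c \<bullet> b) *\<^sub>R A (\<gamma> t) (coord_vector P c b (\<gamma> t)))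
        = A (\<gamma> t) (velocity P UNIV \<gamma> t)"
      using connection_coordinates[OF P A C1_curve_on_tangent[OF P \<gamma>] c(1)] by (auto simp: I_def)
  qed
  then show "continuous (at t0) (\<lambda>t. A (\<gamma> t) (velocity P UNIV \<gamma> t))"
    using I by (simp add: continuous_on_eq_continuous_at)
qed

lemma smooth_map2_curve_continuous:
  assumes M: "smooth_atlas M" and F: "smooth_map2 M D S N F" and c: "c \<in> M"
    and \<xi>: "\<And>t. t \<in> J \<Longrightarrow> \<xi> t \<in> coord c ` (dom c \<inter> D)" "continuous_on J \<xi>"
    and g: "\<And>t. t \<in> J \<Longrightarrow> g t \<in> S" "continuous_on J g"
  shows "continuous_on J (\<lambda>t. F (coord_inv c (\<xi> t)) (g t))"
proof -
  have "continuous_on J (\<lambda>t. coord_inv c (\<xi> t))"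
    by (rule continuous_on_compose2[OF chart_simps(5)[OF M c] \<xi>(2)]) (use \<xi>(1) in auto)
  then have *: "continuous_on J (\<lambda>t. (coord_inv c (\<xi> t), g t))" using g(2) by (rule continuous_on_Pair)
  have "(\<lambda>t. (coord_inv c (\<xi> t), g t)) ` J \<subseteq> D \<times> S"
    using \<xi>(1) g(1) chart_simps(2)[OF M c] by force
  moreover have "continuous_on (D \<times> S) (\<lambda>(x, s). F x s)" using F by (simp add: smooth_map2_def)
  ultimately show ?thesis using continuous_on_compose2[OF _ *] by fastforce
qed

lemma smooth_map2_domain:
  assumes M: "smooth_atlas M" and c: "c \<in> M" and z: "z \<in> coord c ` (dom c \<inter> D)" and "s \<in> S"
    and "F (coord_inv c z) s \<in> dom d"
  shows "(z, s) \<in> {(coord c x, s) | x s. x \<in> dom c \<inter> D \<and> s \<in> S \<and> F x s \<in> dom d}"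
proof -
  obtain x where "x \<in> dom c \<inter> D" "z = coord c x" using z by blast
  then show ?thesis using assms chart_simps(2)[OF M c] by auto
qed

lemma smooth_map2_curve:
  assumes M: "smooth_atlas M" and N: "smooth_atlas N" and F: "smooth_map2 M D S N F" and c: "c \<in> M"
    and J: "open J"
    and \<xi>: "\<And>t. t \<in> J \<Longrightarrow> \<xi> t \<in> coord c ` (dom c \<inter> D)"
      "\<And>t. t \<in> J \<Longrightarrow> (\<xi> has_vector_derivative \<xi>' t) (at t)" "continuous_on J \<xi>'"
    and g: "\<And>t. t \<in> J \<Longrightarrow> g t \<in> S"
      "\<And>t. t \<in> J \<Longrightarrow> (g has_vector_derivative g' t) (at t)" "continuous_on J g'"
  shows "C1_curve_on N J (\<lambda>t. F (coord_inv c (\<xi> t)) (g t))"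
proof -
  define \<gamma> where "\<gamma> t = F (coord_inv c (\<xi> t)) (g t)" for t
  have cont: "continuous_on J \<xi>" "continuous_on J g"
    using \<xi>(2) g(2) by (meson continuous_at_imp_continuous_on has_vector_derivative_continuous)+
  have \<gamma>: "continuous_on J \<gamma>"
    unfolding \<gamma>_def by (rule smooth_map2_curve_continuous[OF M F c \<xi>(1) cont(1) g(1) cont(2)])
  have "(\<forall>t\<in>J \<inter> \<gamma> -` dom d. (coord d \<circ> \<gamma>) differentiable (at t)) \<and>
        continuous_on (J \<inter> \<gamma> -` dom d) (\<lambda>t. vector_derivative (coord d \<circ> \<gamma>) (at t))" if d: "d \<in> N" for d
  proof -
    define \<kappa> where "\<kappa> t = (\<xi> t, g t)" for t
    define f where "f = (\<lambda>(y, s). coord d (F (coord_inv c y) s))"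
    have f: "smooth_on {(coord c x, s) | x s. x \<in> dom c \<inter> D \<and> s \<in> S \<and> F x s \<in> dom d} f"
      using F c d by (simp add: smooth_map2_def f_def)
    have I: "open (J \<inter> \<gamma> -` dom d)"
      by (rule continuous_open_preimage[OF \<gamma> J chart_simps(1)[OF N d]])
    have eq: "coord d \<circ> \<gamma> = (\<lambda>t. f (\<kappa> t))" by (simp add: fun_eq_iff f_def \<kappa>_def \<gamma>_def)
    have 1: "\<kappa> t \<in> {(coord c x, s) | x s. x \<in> dom c \<inter> D \<and> s \<in> S \<and> F x s \<in> dom d}"
      if "t \<in> J \<inter> \<gamma> -` dom d" for t
      unfolding \<kappa>_def using that \<xi>(1) g(1) by (intro smooth_map2_domain[OF M c]) (auto simp: \<gamma>_def)
    have 2: "(\<kappa> has_vector_derivative (\<xi>' t, g' t)) (at t)" if "t \<in> J \<inter> \<gamma> -` dom d" for t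
      unfolding \<kappa>_def using that \<xi>(2) g(2) by (auto intro: has_vector_derivative_Pair)
    have 3: "continuous_on (J \<inter> \<gamma> -` dom d) (\<lambda>t. (\<xi>' t, g' t))"
      using \<xi>(3) g(3) by (auto intro!: continuous_on_Pair intro: continuous_on_subset)
    show ?thesis unfolding eq
      using smooth_on_C1_curve[OF f I 1 2 3] by blast
  qed
  then have "C1_curve_on N J \<gamma>" using J \<gamma> by (simp add: C1_curve_on_def)
  then show ?thesis by (simp add: \<gamma>_def[abs_def])
qed

lemma smooth_map2_curve_derivative:
  assumes M: "smooth_atlas M" and N: "smooth_atlas N" and F: "smooth_map2 M D S N F" and c: "c \<in> M"
    and z: "z \<in> coord c ` (dom c \<inter> D)" and s: "s \<in> S" and d: "d \<in> N" and zs: "F (coord_inv c z) s \<in> dom d"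
  obtains F' where "linear F'"
    "\<And>J \<xi> g t a b. open J \<Longrightarrow> t \<in> J \<Longrightarrow> (\<And>\<tau>. \<tau> \<in> J \<Longrightarrow> \<xi> \<tau> \<in> coord c ` (dom c \<inter> D)) \<Longrightarrow>
      (\<And>\<tau>. \<tau> \<in> J \<Longrightarrow> g \<tau> \<in> S) \<Longrightarrow> continuous_on J \<xi> \<Longrightarrow> continuous_on J g \<Longrightarrow> \<xi> t = z \<Longrightarrow> g t = s \<Longrightarrow>
      (\<xi> has_vector_derivative a) (at t) \<Longrightarrow> (g has_vector_derivative b) (at t) \<Longrightarrow>
      (coord d \<circ> (\<lambda>\<tau>. F (coord_inv c (\<xi> \<tau>)) (g \<tau>)) has_vector_derivative F' (a, b)) (at t)"
proof -
  define X where "X = {(coord c x, s) | x s. x \<in> dom c \<inter> D \<and> s \<in> S \<and> F x s \<in> dom d}"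
  define f where "f = (\<lambda>(y, s). coord d (F (coord_inv c y) s))"
  have f: "smooth_on X f" using F c d by (simp add: smooth_map2_def f_def X_def)
  have zs': "(z, s) \<in> X" unfolding X_def by (rule smooth_map2_domain[where F = F, OF M c z s zs])
  obtain F' where F': "linear F'"
    "\<And>\<kappa> t v. \<kappa> t = (z, s) \<Longrightarrow> (\<kappa> has_vector_derivative v) (at t) \<Longrightarrow> \<forall>\<^sub>F \<tau> in nhds t. \<kappa> \<tau> \<in> X \<Longrightarrow>
      ((\<lambda>\<tau>. f (\<kappa> \<tau>)) has_vector_derivative F' v) (at t)"
    using smooth_on_chain[OF f zs'] by blast
  show ?thesis
  proof (rule that[OF F'(1)])
    fix J \<xi> g t a b
    assume J: "open J" "t \<in> J" and \<xi>: "\<And>\<tau>. \<tau> \<in> J \<Longrightarrow> \<xi> \<tau> \<in> coord c ` (dom c \<inter> D)"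
      and g: "\<And>\<tau>. \<tau> \<in> J \<Longrightarrow> g \<tau> \<in> S" and cont: "continuous_on J \<xi>" "continuous_on J g"
      and t: "\<xi> t = z" "g t = s"
      and der: "(\<xi> has_vector_derivative a) (at t)" "(g has_vector_derivative b) (at t)"
    define \<gamma> where "\<gamma> \<tau> = F (coord_inv c (\<xi> \<tau>)) (g \<tau>)" for \<tau>
    have "continuous_on J \<gamma>"
      unfolding \<gamma>_def by (rule smooth_map2_curve_continuous[OF M F c \<xi> cont(1) g cont(2)])
    from continuous_open_preimage[OF this J(1) chart_simps(1)[OF N d]]
    have "open (J \<inter> \<gamma> -` dom d)" .
    moreover have "t \<in> J \<inter> \<gamma> -` dom d" using J t zs by (simp add: \<gamma>_def)
    ultimately have "\<forall>\<^sub>F \<tau> in nhds t. \<tau> \<in> J \<inter> \<gamma> -` dom d" by (rule eventually_nhds_in_open)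
    then have "\<forall>\<^sub>F \<tau> in nhds t. (\<xi> \<tau>, g \<tau>) \<in> X"
      unfolding X_def
      by eventually_elim
        (rule smooth_map2_domain[where F = F, OF M c], use \<xi> g in \<open>auto simp: \<gamma>_def\<close>)
    then have "((\<lambda>\<tau>. f (\<xi> \<tau>, g \<tau>)) has_vector_derivative F' (a, b)) (at t)"
      using t der by (intro F'(2) has_vector_derivative_Pair) auto
    then show "(coord d \<circ> (\<lambda>\<tau>. F (coord_inv c (\<xi> \<tau>)) (g \<tau>)) has_vector_derivative F' (a, b)) (at t)"
      by (simp add: f_def o_def)
  qed
qed

text \<open>
  The product rule: the velocity of \<open>\<tau> \<mapsto> F(x(\<tau>), g(\<tau>))\<close> is the sum of the velocities obtained by
  varying one argument at a time.  The curve that varies only \<open>g\<close> is reparametrized to start at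
  time \<open>0\<close>, where the fundamental vector fields of a principal bundle are defined.
\<close>

lemma smooth_map2_velocity_sum:
  assumes M: "smooth_atlas M" and N: "smooth_atlas N" and F: "smooth_map2 M D S N F" and c: "c \<in> M"
    and J: "open J" "t \<in> J"
    and \<xi>: "\<And>\<tau>. \<tau> \<in> J \<Longrightarrow> \<xi> \<tau> \<in> coord c ` (dom c \<inter> D)" "continuous_on J \<xi>"
      "(\<xi> has_vector_derivative a) (at t)"
    and g: "\<And>\<tau>. \<tau> \<in> J \<Longrightarrow> g \<tau> \<in> S" "continuous_on J g"
      "(g has_vector_derivative b) (at t)"
  shows "velocity N UNIV (\<lambda>\<tau>. F (coord_inv c (\<xi> \<tau>)) (g \<tau>)) t =
    (\<lambda>d. velocity N UNIV (\<lambda>\<tau>. F (coord_inv c (\<xi> \<tau>)) (g t)) t d +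
      velocity N UNIV (\<lambda>\<tau>. F (coord_inv c (\<xi> t)) (g (t + \<tau>))) 0 d)"
proof
  fix d
  show "velocity N UNIV (\<lambda>\<tau>. F (coord_inv c (\<xi> \<tau>)) (g \<tau>)) t d =
    velocity N UNIV (\<lambda>\<tau>. F (coord_inv c (\<xi> \<tau>)) (g t)) t d +
      velocity N UNIV (\<lambda>\<tau>. F (coord_inv c (\<xi> t)) (g (t + \<tau>))) 0 d"
  proof (cases "d \<in> N \<and> F (coord_inv c (\<xi> t)) (g t) \<in> dom d")
    case True
    then have d: "d \<in> N" "F (coord_inv c (\<xi> t)) (g t) \<in> dom d" by auto
    obtain F' where F': "linear F'"
      "\<And>J' \<xi>' g' t' a b. open J' \<Longrightarrow> t' \<in> J' \<Longrightarrow> (\<And>\<tau>. \<tau> \<in> J' \<Longrightarrow> \<xi>' \<tau> \<in> coord c ` (dom c \<inter> D)) \<Longrightarrow>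
      (\<And>\<tau>. \<tau> \<in> J' \<Longrightarrow> g' \<tau> \<in> S) \<Longrightarrow> continuous_on J' \<xi>' \<Longrightarrow> continuous_on J' g' \<Longrightarrow> \<xi>' t' = \<xi> t \<Longrightarrow> g' t' = g t \<Longrightarrow>
      (\<xi>' has_vector_derivative a) (at t') \<Longrightarrow> (g' has_vector_derivative b) (at t') \<Longrightarrow>
      (coord d \<circ> (\<lambda>\<tau>. F (coord_inv c (\<xi>' \<tau>)) (g' \<tau>)) has_vector_derivative F' (a, b)) (at t')"
      using smooth_map2_curve_derivative[OF M N F c \<xi>(1)[OF J(2)] g(1)[OF J(2)] d] by blast
    have 1: "(coord d \<circ> (\<lambda>\<tau>. F (coord_inv c (\<xi> \<tau>)) (g \<tau>)) has_vector_derivative F' (a, b)) (at t)"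
      by (rule F'(2)[of J t \<xi> g a b]) (use J \<xi> g in auto)
    have 2: "(coord d \<circ> (\<lambda>\<tau>. F (coord_inv c (\<xi> \<tau>)) (g t)) has_vector_derivative F' (a, 0)) (at t)"
      by (rule F'(2)[of J t \<xi> "\<lambda>_. g t" a 0]) (use J \<xi> g in auto)
    have J': "open ((\<lambda>\<tau>. t + \<tau>) -` J)" using J(1) by (intro open_vimage) (auto intro: continuous_intros)
    have g': "((\<lambda>\<tau>. g (t + \<tau>)) has_vector_derivative b) (at 0)"
    proof -
      have "((\<lambda>\<tau>. t + \<tau>) has_vector_derivative 1) (at 0)"
        by (auto intro!: derivative_eq_intros simp: has_vector_derivative_def)
      then have "((g \<circ> (\<lambda>\<tau>. t + \<tau>)) has_vector_derivative 1 *\<^sub>R b) (at 0)"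
        using g(3) by (intro vector_diff_chain_at) auto
      then show ?thesis by (simp add: o_def)
    qed
    have 3: "(coord d \<circ> (\<lambda>\<tau>. F (coord_inv c (\<xi> t)) (g (t + \<tau>))) has_vector_derivative F' (0, b)) (at 0)"
    proof (rule F'(2)[of "(+) t -` J" 0 "\<lambda>_. \<xi> t" "\<lambda>\<tau>. g (t + \<tau>)" 0 b, OF J'])
      show "continuous_on ((+) t -` J) (\<lambda>\<tau>. g (t + \<tau>))"
        by (rule continuous_on_compose2[OF g(2)]) (auto intro: continuous_intros)
    qed (use g(1) g' \<xi>(1) J in auto)
    have "F' (a, b) = F' (a, 0) + F' (0, b)"
      using linear_add[OF F'(1), of "(a, 0)" "(0, b)"] by simp
    then show ?thesis
      using d 1 2 3 by (simp add: velocity_def vector_derivative_at)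
  qed (auto simp: velocity_def)
qed

text \<open>
  For fixed \<open>s\<close> the map is differentiable in the ordinary sense, because its domain in a chart is
  open, although the domain in both variables need not be.
\<close>

lemma smooth_map2_slice_differentiable:
  assumes M: "smooth_atlas M" and N: "smooth_atlas N" and F: "smooth_map2 M UNIV S N F" and s: "s \<in> S"
    and c: "c \<in> M" "p \<in> dom c" and d: "d \<in> N" "F p s \<in> dom d"
  shows "((coord d \<circ> (\<lambda>q. F q s)) \<circ> coord_inv c) differentiable (at (coord c p))"
proof -
  define X where "X = {(coord c x, s) | x s. x \<in> dom c \<inter> UNIV \<and> s \<in> S \<and> F x s \<in> dom d}"
  define f where "f = (\<lambda>(y, s). coord d (F (coord_inv c y) s))"
  have f: "smooth_on X f" using F c d unfolding smooth_map2_def f_def X_def by blast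
  have x: "(coord c p, s) \<in> X" unfolding X_def using c d s by auto
  obtain W H where H: "open W" "(coord c p, s) \<in> W" "\<And>k. C_on k W H" "\<And>y. y \<in> W \<Longrightarrow> y \<in> X \<Longrightarrow> H y = f y"
    using smooth_onE[OF f x] by metis
  have "((\<lambda>z. (z, s)) has_derivative (\<lambda>u. (u, 0))) (at (coord c p))"
    by (auto intro!: derivative_eq_intros)
  from diff_chain_at[OF this C_on_derivative[OF H(3,2)]]
  have H': "(H \<circ> (\<lambda>z. (z, s)) has_derivative
      frechet_derivative H (at (coord c p, s)) \<circ> (\<lambda>u. (u, 0))) (at (coord c p))" .
  have "continuous_on (UNIV \<times> S) (\<lambda>(x, s). F x s)" using F by (simp add: smooth_map2_def)
  then have "continuous_on UNIV ((\<lambda>(x, s). F x s) \<circ> (\<lambda>q. (q, s)))"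
    using s by (intro continuous_on_compose continuous_intros) (auto intro: continuous_on_subset)
  then have "open ((\<lambda>q. F q s) -` dom d)"
    using open_vimage[OF chart_simps(1)[OF N d(1)]] by (simp add: o_def)
  from chart_open_image[OF M c(1) this]
  have "open (coord c ` (dom c \<inter> (\<lambda>q. F q s) -` dom d))" .
  moreover have "open ((\<lambda>z. (z, s)) -` W)" using H(1) by (intro open_vimage) (auto intro: continuous_intros)
  ultimately have op: "open (coord c ` (dom c \<inter> (\<lambda>q. F q s) -` dom d) \<inter> (\<lambda>z. (z, s)) -` W)" by blast
  have "((coord d \<circ> (\<lambda>q. F q s)) \<circ> coord_inv c has_derivative
      frechet_derivative H (at (coord c p, s)) \<circ> (\<lambda>u. (u, 0))) (at (coord c p))"
  proof (rule has_derivative_transform_within_open[OF H' op])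
    fix z assume z: "z \<in> coord c ` (dom c \<inter> (\<lambda>q. F q s) -` dom d) \<inter> (\<lambda>z. (z, s)) -` W"
    then have "(z, s) \<in> X" using s by (auto simp: X_def)
    then show "(H \<circ> (\<lambda>z. (z, s))) z = ((coord d \<circ> (\<lambda>q. F q s)) \<circ> coord_inv c) z"
      using H(4)[of "(z, s)"] z by (simp add: f_def)
  qed (use c d H(2) in auto)
  then show ?thesis by (rule differentiableI)
qed

lemma pushforward_velocity:
  assumes P: "smooth_atlas P" and act: "smooth_map2 P UNIV S P act" and g: "g \<in> S"
    and \<gamma>: "C1_curve_on P J \<gamma>" and t: "t \<in> J"
  shows "velocity P UNIV (\<lambda>\<tau>. act (\<gamma> \<tau>) g) t = pushforward P (\<lambda>q. act q g) (\<gamma> t) (velocity P UNIV \<gamma> t)"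
proof
  fix d
  show "velocity P UNIV (\<lambda>\<tau>. act (\<gamma> \<tau>) g) t d = pushforward P (\<lambda>q. act q g) (\<gamma> t) (velocity P UNIV \<gamma> t) d"
  proof (cases "d \<in> P \<and> act (\<gamma> t) g \<in> dom d")
    case True
    then have d: "d \<in> P" "act (\<gamma> t) g \<in> dom d" by auto
    have "((coord d \<circ> (\<lambda>q. act q g)) \<circ> \<gamma> has_vector_derivative
        differential P (coord d \<circ> (\<lambda>q. act q g)) (\<gamma> t) (velocity P UNIV \<gamma> t)) (at t)"
      by (rule differential_velocity[OF P UNIV_I C1_curve_on_continuous[OF \<gamma> t]
            C1_curve_on_differentiable[OF \<gamma> t] smooth_map2_slice_differentiable[OF P P act g _ _ d]])
    from vector_derivative_at[OF this] show ?thesis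
      using True by (simp add: velocity_def pushforward_def o_def)
  qed (auto simp: velocity_def pushforward_def)
qed


section \<open>Horizontal lifts\<close>

lemma connection_formD:
  assumes "connection_form P act A"
  shows "X \<in> tangent_space P p \<Longrightarrow> A p X \<in> lie_G"
    and "X \<in> tangent_space P p \<Longrightarrow> Y \<in> tangent_space P p \<Longrightarrow> A p (\<lambda>c. X c + Y c) = A p X + A p Y"
    and "range h \<subseteq> G \<Longrightarrow> h 0 = gone \<Longrightarrow> (h has_vector_derivative \<xi>) (at 0) \<Longrightarrow>
        A p (velocity P UNIV (\<lambda>t. act p (h t)) 0) = \<xi>"
    and "g \<in> G \<Longrightarrow> X \<in> tangent_space P p \<Longrightarrow>
        A (act p g) (pushforward P (\<lambda>q. act q g) p X) = Ad (ginv g) (A p X)"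
  using assms unfolding connection_form_def by blast+

lemma principal_bundleD:
  assumes "principal_bundle M P \<pi> act"
  shows "smooth_atlas M" "smooth_atlas P" "smooth_map2 P UNIV G P act" "act p gone = p"
    "g \<in> G \<Longrightarrow> h \<in> G \<Longrightarrow> act p (gmul g h) = act (act p g) h"
    "g \<in> G \<Longrightarrow> \<pi> (act p g) = \<pi> p"
    "\<exists>D h. x \<in> D \<and> local_trivialization M P \<pi> act D h"
  using assms unfolding principal_bundle_def by blast+

lemma local_trivializationE:
  assumes "local_trivialization M P \<pi> act D h" and pb: "principal_bundle M P \<pi> act"
  obtains \<Psi> where "smooth_map2 M D G P \<Psi>"
    "\<And>x g. x \<in> D \<Longrightarrow> g \<in> G \<Longrightarrow> \<pi> (\<Psi> x g) = x"
    "\<And>p. \<pi> p \<in> D \<Longrightarrow> h p \<in> G \<and> \<Psi> (\<pi> p) (h p) = p"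
    "\<And>x g k. x \<in> D \<Longrightarrow> g \<in> G \<Longrightarrow> k \<in> G \<Longrightarrow> act (\<Psi> x g) k = \<Psi> x (gmul g k)"
proof -
  obtain \<Psi> where \<Psi>: "smooth_map2 M D G P \<Psi>"
    "\<And>x g. x \<in> D \<Longrightarrow> g \<in> G \<Longrightarrow> \<pi> (\<Psi> x g) = x \<and> h (\<Psi> x g) = g"
    "\<And>p. \<pi> p \<in> D \<Longrightarrow> \<Psi> (\<pi> p) (h p) = p"
    using assms(1) unfolding local_trivialization_def by auto
  have h: "h p \<in> G" "g \<in> G \<Longrightarrow> h (act p g) = gmul (h p) g" if "\<pi> p \<in> D" for p g
    using that assms(1) unfolding local_trivialization_def by auto
  have "act (\<Psi> x g) k = \<Psi> x (gmul g k)" if "x \<in> D" "g \<in> G" "k \<in> G" for x g k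
    using that \<Psi>(2)[of x g] \<Psi>(3)[of "act (\<Psi> x g) k"] h(2)[of "\<Psi> x g" k]
      principal_bundleD(6)[OF pb] by simp
  then show ?thesis using \<Psi> h(1) by (intro that[of \<Psi>]) auto
qed

lemma fibre_transitive:
  assumes pb: "principal_bundle M P \<pi> act" and "\<pi> p = \<pi> q"
  obtains g where "g \<in> G" "p = act q g"
proof -
  obtain D h where D: "\<pi> p \<in> D" "local_trivialization M P \<pi> act D h"
    using principal_bundleD(7)[OF pb] by blast
  obtain \<Psi> where \<Psi>: "\<And>p. \<pi> p \<in> D \<Longrightarrow> h p \<in> G \<and> \<Psi> (\<pi> p) (h p) = p"
    "\<And>x g k. x \<in> D \<Longrightarrow> g \<in> G \<Longrightarrow> k \<in> G \<Longrightarrow> act (\<Psi> x g) k = \<Psi> x (gmul g k)"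
    using local_trivializationE[OF D(2) pb] by metis
  have h: "h p \<in> G" "h q \<in> G" "\<Psi> (\<pi> p) (h p) = p" "\<Psi> (\<pi> p) (h q) = q"
    using \<Psi>(1)[of p] \<Psi>(1)[of q] D(1) assms(2) by auto
  have g: "gmul (ginv (h q)) (h p) \<in> G" using h by (simp add: gmul_closed ginv_closed)
  have "act q (gmul (ginv (h q)) (h p)) = p"
    using \<Psi>(2)[OF D(1) h(2) g] h by (simp add: gmul_inv_cancel)
  then show ?thesis using that g by metis
qed

text \<open>
  The function is defined on the whole line with values in \<open>G\<close>, since the axiom for the values of a
  connection on fundamental vector fields speaks of curves \<open>\<real> \<rightarrow> G\<close>.
\<close>

lemma horizontal_ode:
  assumes B: "continuous_on {a..b} B" "\<And>t. t \<in> {a..b} \<Longrightarrow> B t \<in> lie_G"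
    and t0: "t\<^sub>0 \<in> {a..b}" and k: "k \<in> G"
  obtains g where "range g \<subseteq> G" "g t\<^sub>0 = k"
    "\<And>t. t \<in> {a<..<b} \<Longrightarrow> (g has_vector_derivative gmul (- B t) (g t)) (at t)"
proof -
  have "continuous_on {a..b} (\<lambda>t. - B t)" "a \<le> b" using B(1) t0 by (auto intro: continuous_intros)
  then obtain y where y: "y a = gone"
    "\<And>t. t \<in> {a..b} \<Longrightarrow> (y has_vector_derivative gmul (- B t) (y t)) (at t within {a..b})"
    using linear_ode_solution[OF bounded_bilinear_gmul] by blast
  have yG: "y t \<in> G" if "t \<in> {a..b}" for t
    using ode_stays_in_G[OF y(2) B(2) _ that] y(1) gone_in_G by simp
  \<comment> \<open>Right translates of solutions are solutions; this one has the prescribed value at \<open>t\<^sub>0\<close>.\<close>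
  define k' where "k' = gmul (ginv (y t\<^sub>0)) k"
  have k': "k' \<in> G" using k yG[OF t0] by (simp add: k'_def gmul_closed ginv_closed)
  define g where "g t = (if t \<in> {a..b} then gmul (y t) k' else gone)" for t
  show ?thesis
  proof (rule that[of g])
    have "g t \<in> G" for t unfolding g_def using gmul_closed[OF yG k'] gone_in_G by simp
    then show "range g \<subseteq> G" by blast
    show "g t\<^sub>0 = k" using t0 yG[OF t0] by (simp add: g_def k'_def gmul_inv_cancel)
    fix t assume t: "t \<in> {a<..<b}"
    have "(y has_vector_derivative gmul (- B t) (y t)) (at t)"
      using y(2)[of t] t by (simp add: at_within_Icc_at)
    then have "((\<lambda>t. gmul (y t) k') has_vector_derivative gmul (gmul (- B t) (y t)) k') (at t)"
      by (rule bounded_linear.has_vector_derivative[OF gmul.bounded_linear_left])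
    then have "(g has_vector_derivative gmul (gmul (- B t) (y t)) k') (at t)"
      by (rule has_vector_derivative_transform_within_open[of _ _ _ "{a<..<b}"])
        (use t in \<open>auto simp: g_def\<close>)
    then show "(g has_vector_derivative gmul (- B t) (g t)) (at t)"
      using t by (simp add: g_def gmul_assoc)
  qed
qed

text \<open>
  Let \<open>s(t) = \<Psi>(x(t), 1)\<close> be the lift of \<open>x(t)\<close> in the trivialization and \<open>B(t)\<close> the value of \<open>A\<close> on
  its velocity.  By the product rule, equivariance and the axiom for fundamental vector fields, \<open>A\<close>
  takes the value \<open>g\<^sup>-\<^sup>1 B g + g\<^sup>-\<^sup>1 g'\<close> on the velocity of \<open>\<Psi>(x(t), g(t)) = s(t) \<cdot> g(t)\<close>; it vanishes
  for \<open>g' = - B g\<close>.  The curve is given on a neighbourhood of \<open>[-1, 2]\<close> in order that all times in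
  \<open>[0, 1]\<close> are interior points of the interval on which the equation is solved.
\<close>

lemma horizontal_lift:
  fixes \<xi> :: "real \<Rightarrow> 'e::euclidean_space"
  assumes pb: "principal_bundle M P \<pi> act" and A: "connection_form P act A"
    and D: "local_trivialization M P \<pi> act D h" and c: "c \<in> M"
    and J: "open J" "{-1..2} \<subseteq> J"
    and \<xi>: "\<And>t. t \<in> J \<Longrightarrow> \<xi> t \<in> coord c ` (dom c \<inter> D)"
      "\<And>t. t \<in> J \<Longrightarrow> (\<xi> has_vector_derivative \<xi>' t) (at t)" "continuous_on J \<xi>'"
    and q: "\<pi> q = coord_inv c (\<xi> 0)"
  obtains \<gamma> where "horizontal_curve P A \<gamma>" "\<gamma> 0 = q" "\<pi> (\<gamma> 1) = coord_inv c (\<xi> 1)"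
proof -
  note M = principal_bundleD(1)[OF pb] and P = principal_bundleD(2)[OF pb]
    and act = principal_bundleD(3)[OF pb]
  obtain \<Psi> where \<Psi>: "smooth_map2 M D G P \<Psi>"
    "\<And>x g. x \<in> D \<Longrightarrow> g \<in> G \<Longrightarrow> \<pi> (\<Psi> x g) = x"
    "\<And>p. \<pi> p \<in> D \<Longrightarrow> h p \<in> G \<and> \<Psi> (\<pi> p) (h p) = p"
    "\<And>x g k. x \<in> D \<Longrightarrow> g \<in> G \<Longrightarrow> k \<in> G \<Longrightarrow> act (\<Psi> x g) k = \<Psi> x (gmul g k)"
    using local_trivializationE[OF D pb] by metis
  define x where "x t = coord_inv c (\<xi> t)" for t
  have xD: "x t \<in> D" if "t \<in> J" for t
    using \<xi>(1)[OF that] chart_simps(2)[OF M c] by (auto simp: x_def)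
  define s where "s t = \<Psi> (x t) gone" for t
  have s: "C1_curve_on P J s"
    unfolding s_def x_def
    by (rule smooth_map2_curve[OF M P \<Psi>(1) c J(1) \<xi>, where g' = "\<lambda>_. 0"])
      (auto simp: gone_in_G)
  define B where "B t = A (s t) (velocity P UNIV s t)" for t
  have B: "continuous_on J B" "\<And>t. t \<in> J \<Longrightarrow> B t \<in> lie_G"
    using connection_along_curve_continuous[OF P A s] C1_curve_on_tangent[OF P s] connection_formD(1)[OF A]
    by (auto simp: B_def)
  have 01: "{0..1} \<subseteq> J" "0 \<in> J" "1 \<in> J" using J(2) by auto
  have hq: "h q \<in> G" "\<Psi> (x 0) (h q) = q" using \<Psi>(3)[of q] q xD[of 0] 01 by (auto simp: x_def)
  obtain g where g: "range g \<subseteq> G" "g 0 = h q"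
    "\<And>t. t \<in> {-1<..<2} \<Longrightarrow> (g has_vector_derivative gmul (- B t) (g t)) (at t)"
    by (rule horizontal_ode[of "-1" 2 B 0 "h q"])
      (use B J(2) hq(1) in \<open>auto intro: continuous_on_subset\<close>)
  have gG: "g t \<in> G" for t using g(1) by auto
  define I where "I = {-1<..<(2::real)}"
  have I: "open I" "I \<subseteq> J" using J(2) by (auto simp: I_def)
  have g_cont: "continuous_on I g"
    using has_vector_derivative_continuous[OF g(3)]
    by (simp add: I_def continuous_at_imp_continuous_on)
  have g'_cont: "continuous_on I (\<lambda>t. gmul (- B t) (g t))"
    using B(1) I(2) by (intro gmul.continuous_on continuous_intros g_cont) (auto intro: continuous_on_subset)
  have \<xi>_cont: "continuous_on I \<xi>"
    using has_vector_derivative_continuous[OF \<xi>(2)] I(2)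
    by (simp add: continuous_at_imp_continuous_on subset_iff)
  define \<gamma> where "\<gamma> t = \<Psi> (x t) (g t)" for t
  have \<gamma>: "C1_curve_on P I \<gamma>"
    unfolding \<gamma>_def x_def
    by (rule smooth_map2_curve[OF M P \<Psi>(1) c I(1), where \<xi>' = \<xi>' and g' = "\<lambda>t. gmul (- B t) (g t)"])
      (use \<xi> I(2) gG g(3) g'_cont in \<open>auto simp: I_def intro: continuous_on_subset\<close>)
  have horizontal: "A (\<gamma> t) (velocity P UNIV \<gamma> t) = 0" if t: "t \<in> {0..1}" for t
  proof -
    have tI: "t \<in> I" and tJ: "t \<in> J" using t 01 by (auto simp: I_def)
    note g' = g(3)[OF tI[unfolded I_def]]
    define \<gamma>1 where "\<gamma>1 \<tau> = \<Psi> (x \<tau>) (g t)" for \<tau>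
    define \<gamma>2 where "\<gamma>2 \<tau> = \<Psi> (x t) (g (t + \<tau>))" for \<tau>
    have sum: "velocity P UNIV \<gamma> t = (\<lambda>d. velocity P UNIV \<gamma>1 t d + velocity P UNIV \<gamma>2 0 d)"
      unfolding \<gamma>_def \<gamma>1_def \<gamma>2_def x_def
      by (rule smooth_map2_velocity_sum[OF M P \<Psi>(1) c I(1) tI _ \<xi>_cont \<xi>(2)[OF tJ] gG g_cont g'])
        (use \<xi>(1) I(2) in auto)
    have \<gamma>1: "C1_curve_on P I \<gamma>1"
      unfolding \<gamma>1_def x_def
      by (rule smooth_map2_curve[OF M P \<Psi>(1) c I(1), where \<xi>' = \<xi>' and g' = "\<lambda>t. 0"])
        (use \<xi> I(2) gG in \<open>auto intro: continuous_on_subset\<close>)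
    have J': "open ((+) t -` I)" using I(1) by (intro open_vimage) (auto intro: continuous_intros)
    have shift: "((\<lambda>\<tau>. g (t + \<tau>)) has_vector_derivative gmul (- B (t + \<tau>)) (g (t + \<tau>))) (at \<tau>)"
      if "t + \<tau> \<in> I" for \<tau>
    proof -
      have "((\<lambda>\<tau>. t + \<tau>) has_vector_derivative 1) (at \<tau>)"
        by (auto intro!: derivative_eq_intros simp: has_vector_derivative_def)
      then have "((g \<circ> (\<lambda>\<tau>. t + \<tau>)) has_vector_derivative 1 *\<^sub>R gmul (- B (t + \<tau>)) (g (t + \<tau>))) (at \<tau>)"
        using g(3) that by (intro vector_diff_chain_at) (auto simp: I_def)
      then show ?thesis by (simp add: o_def)
    qed
    have \<gamma>2: "C1_curve_on P ((+) t -` I) \<gamma>2"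
      unfolding \<gamma>2_def x_def
    proof (rule smooth_map2_curve[OF M P \<Psi>(1) c J', where \<xi>' = "\<lambda>_. 0"
          and g' = "\<lambda>\<tau>. gmul (- B (t + \<tau>)) (g (t + \<tau>))"])
      show "continuous_on ((+) t -` I) (\<lambda>\<tau>. gmul (- B (t + \<tau>)) (g (t + \<tau>)))"
        by (rule continuous_on_compose2[OF g'_cont]) (auto intro: continuous_intros)
    qed (use \<xi>(1)[OF tJ] gG shift in auto)
    have "A (\<gamma> t) (velocity P UNIV \<gamma>1 t) = Ad (ginv (g t)) (B t)"
    proof -
      have eq: "\<gamma>1 \<tau> = act (s \<tau>) (g t)" if "\<tau> \<in> J" for \<tau>
        using \<Psi>(4)[OF xD[OF that] gone_in_G gG] by (simp add: \<gamma>1_def s_def)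
      have "velocity P UNIV \<gamma>1 t = pushforward P (\<lambda>q. act q (g t)) (s t) (velocity P UNIV s t)"
        unfolding pushforward_velocity[OF P act gG s tJ, symmetric]
        by (rule velocity_cong[OF J(1) tJ]) (rule eq)
      moreover have "\<gamma> t = act (s t) (g t)" using eq[OF tJ] by (simp add: \<gamma>1_def \<gamma>_def)
      ultimately show ?thesis
        using connection_formD(4)[OF A gG C1_curve_on_tangent[OF P s tJ]] by (simp add: B_def)
    qed
    moreover have "A (\<gamma> t) (velocity P UNIV \<gamma>2 0) = gmul (ginv (g t)) (gmul (- B t) (g t))"
    proof -
      have "\<gamma>2 = (\<lambda>\<tau>. act (\<gamma> t) (gmul (ginv (g t)) (g (t + \<tau>))))"
        using \<Psi>(4)[OF xD[OF tJ] gG] gG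
        by (simp add: fun_eq_iff \<gamma>2_def \<gamma>_def gmul_closed ginv_closed gmul_inv_cancel)
      moreover have "((\<lambda>\<tau>. gmul (ginv (g t)) (g (t + \<tau>))) has_vector_derivative
          gmul (ginv (g t)) (gmul (- B t) (g t))) (at 0)"
        using shift[of 0] tI by (intro bounded_linear.has_vector_derivative[OF gmul.bounded_linear_right]) auto
      ultimately show ?thesis
        using gG by (auto intro!: connection_formD(3)[OF A] simp: gmul_closed ginv_closed gmul_ginv)
    qed
    moreover have "A (\<gamma> t) (velocity P UNIV \<gamma> t) = A (\<gamma> t) (velocity P UNIV \<gamma>1 t) + A (\<gamma> t) (velocity P UNIV \<gamma>2 0)"
    proof -
      have "\<gamma>1 t = \<gamma> t" "\<gamma>2 0 = \<gamma> t" by (auto simp: \<gamma>1_def \<gamma>2_def \<gamma>_def)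
      then show ?thesis
        unfolding sum
        using C1_curve_on_tangent[OF P \<gamma>1 tI] C1_curve_on_tangent[OF P \<gamma>2, of 0] tI
        by (intro connection_formD(2)[OF A]) auto
    qed
    ultimately show ?thesis
      by (simp add: Ad_def gmul.minus_left gmul.minus_right gmul_assoc)
  qed
  show ?thesis
  proof (rule that[of \<gamma>])
    have I01: "{0..1} \<subseteq> I" by (auto simp: I_def)
    show "horizontal_curve P A \<gamma>"
      unfolding horizontal_curve_def
      using C1_curve_on_imp_C1_curve[OF \<gamma> I01] horizontal C1_curve_on_velocity_within[OF \<gamma>] I01 by auto
    show "\<gamma> 0 = q" using hq g(2) by (simp add: \<gamma>_def)
    show "\<pi> (\<gamma> 1) = coord_inv c (\<xi> 1)" using \<Psi>(2)[OF xD[OF 01(3)] gG] by (simp add: \<gamma>_def x_def)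
  qed
qed

text \<open>
  Each point of the base has a neighbourhood \<open>U\<close> in a chart such that any two points of \<open>U\<close> are joined by a
  segment that can be lifted horizontally from any starting point in the fibre.  So \<open>U\<close> lies in the
  projection of the holonomy bundle as soon as it meets it; hence this projection is open and closed.
\<close>

lemma holonomy_bundle_covers_base:
  fixes M :: "('m::{t2_space,second_countable_topology}, 'e::euclidean_space) chart set"
  assumes pb: "principal_bundle M P \<pi> act" and A: "connection_form P act A"
    and conn: "connected (UNIV :: 'm set)"
  shows "\<pi> ` holonomy_bundle P A p\<^sub>0 = UNIV"
proof -
  note M = principal_bundleD(1)[OF pb]
  define R where "R = \<pi> ` holonomy_bundle P A p\<^sub>0"
  have nbhd: "\<exists>U. open U \<and> x \<in> U \<and> (\<forall>y\<in>U. \<forall>z\<in>U. y \<in> R \<longrightarrow> z \<in> R)" for x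
  proof -
    obtain D h where D: "x \<in> D" "local_trivialization M P \<pi> act D h"
      using principal_bundleD(7)[OF pb] by blast
    then have oD: "open D" by (simp add: local_trivialization_def)
    obtain c where c: "c \<in> M" "x \<in> dom c" using chart_at_in[OF M] by blast
    have "open (coord c ` (dom c \<inter> D))" by (rule chart_open_image[OF M c(1) oD])
    then obtain r where r: "r > 0" "ball (coord c x) r \<subseteq> coord c ` (dom c \<inter> D)"
      using c D by (meson IntI imageI openE)
    \<comment> \<open>Lifting requires the segment on the parameter interval \<open>[-1, 2]\<close>, where its distance from the
      centre is less than \<open>2 r / 5 + 2 r / 5 < r\<close>.\<close>
    define U where "U = dom c \<inter> coord c -` ball (coord c x) (r / 5)"
    have U: "open U" "x \<in> U"
      using continuous_open_preimage[OF chart_simps(4)[OF M c(1)] chart_simps(1)[OF M c(1)]] c r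
      by (auto simp: U_def)
    have "z \<in> R" if "y \<in> U" "z \<in> U" "y \<in> R" for y z
    proof -
      obtain q where q: "q \<in> holonomy_bundle P A p\<^sub>0" "\<pi> q = y" using \<open>y \<in> R\<close> by (auto simp: R_def)
      define \<xi> where "\<xi> t = coord c y + t *\<^sub>R (coord c z - coord c y)" for t :: real
      have \<xi>J: "\<xi> t \<in> coord c ` (dom c \<inter> D)" if t: "t \<in> \<xi> -` ball (coord c x) r" for t
        using r t by auto
      have \<xi>': "(\<xi> has_vector_derivative (coord c z - coord c y)) (at t)" for t
        unfolding \<xi>_def by (auto intro!: derivative_eq_intros simp: has_vector_derivative_def)
      have oJ: "open (\<xi> -` ball (coord c x) r)"
        unfolding \<xi>_def by (intro open_vimage) (auto intro!: continuous_intros)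
      have "\<xi> t \<in> ball (coord c x) r" if "t \<in> {-1..2}" for t
      proof -
        have y: "norm (coord c y - coord c x) < r / 5" and z: "norm (coord c z - coord c x) < r / 5"
          using \<open>y \<in> U\<close> \<open>z \<in> U\<close> by (auto simp: U_def dist_norm norm_minus_commute)
        have "\<xi> t - coord c x = (1 - t) *\<^sub>R (coord c y - coord c x) + t *\<^sub>R (coord c z - coord c x)"
          by (simp add: \<xi>_def algebra_simps)
        then have "norm (\<xi> t - coord c x) 
            \<le> \<bar>1 - t\<bar> * norm (coord c y - coord c x) + \<bar>t\<bar> * norm (coord c z - coord c x)"
          using norm_triangle_ineq[of "(1 - t) *\<^sub>R (coord c y - coord c x)"
            "t *\<^sub>R (coord c z - coord c x)"] by simp
        also have "\<dots> \<le> 2 * norm (coord c y - coord c x) + 2 * norm (coord c z - coord c x)"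
          using that by (intro add_mono mult_right_mono) auto
        also have "\<dots> < r" using y z r by simp
        finally show ?thesis by (simp add: dist_norm norm_minus_commute)
      qed
      then have J: "{-1..2} \<subseteq> \<xi> -` ball (coord c x) r" by auto
      have \<xi>01: "coord_inv c (\<xi> 0) = y" "coord_inv c (\<xi> 1) = z"
        using \<open>y \<in> U\<close> \<open>z \<in> U\<close> chart_simps(2)[OF M c(1)] by (auto simp: \<xi>_def U_def)
      obtain \<gamma> where \<gamma>: "horizontal_curve P A \<gamma>" "\<gamma> 0 = q" "\<pi> (\<gamma> 1) = z"
        using horizontal_lift[OF pb A D(2) c(1) oJ J \<xi>J \<xi>'] q(2) \<xi>01 by (metis continuous_on_const)
      have "\<gamma> 1 \<in> holonomy_bundle P A p\<^sub>0"
        using q(1) unfolding holonomy_bundle_def mem_Collect_eq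
        by (rule rtranclp.rtrancl_into_rtrancl) (use \<gamma>(1,2) in blast)
      then show ?thesis using \<gamma>(3) by (auto simp: R_def)
    qed
    then show ?thesis using U by blast
  qed
  have "open R"
  proof (rule topological_space_class.openI)
    show "\<exists>U. open U \<and> x \<in> U \<and> U \<subseteq> R" if "x \<in> R" for x
      using nbhd[of x] that by (meson subsetI)
  qed
  moreover have "open (- R)"
  proof (rule topological_space_class.openI)
    show "\<exists>U. open U \<and> x \<in> U \<and> U \<subseteq> - R" if "x \<in> - R" for x
      using nbhd[of x] that by (meson ComplD ComplI subsetI)
  qed
  ultimately have "R \<inter> UNIV = {} \<or> - R \<inter> UNIV = {}" by (intro connectedD[OF conn]) auto
  moreover have "\<pi> p\<^sub>0 \<in> R" by (auto simp: R_def holonomy_bundle_def)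
  ultimately have "R = UNIV" by auto
  then show ?thesis by (simp only: R_def)
qed


section \<open>Stabilizers of connections and sections\<close>

text \<open>
  All values of \<open>V\<close> are conjugate to \<open>V p\<^sub>0\<close> by elements of \<open>G\<close>, because \<open>V\<close> is constant on the
  holonomy bundle and that bundle meets every fibre.
\<close>

lemma covariantly_constant_in_Gau_A:
  fixes M :: "('m::{t2_space,second_countable_topology}, 'e::euclidean_space) chart set"
  assumes pb: "principal_bundle M P \<pi> act" and A: "connection_form P act A"
    and conn: "connected (UNIV :: 'm set)"
    and V: "covariantly_constant P act A V" "V p\<^sub>0 \<in> G"
  shows "V \<in> Gau_A P act A"
proof -
  note P = principal_bundleD(2)[OF pb]
  have "V p \<in> G" for p
  proof -
    obtain q where q: "q \<in> holonomy_bundle P A p\<^sub>0" "\<pi> p = \<pi> q"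
      using holonomy_bundle_covers_base[OF pb A conn, of p\<^sub>0] by (metis UNIV_I imageE)
    obtain g where g: "g \<in> G" "p = act q g" using fibre_transitive[OF pb q(2)] by blast
    have "V q \<in> G" using covariantly_constant_holonomy_bundle[OF P V(1) q(1)] V(2) by simp
    moreover have "V p = gmul (gmul (ginv g) (V q)) g"
      using V(1) g by (simp add: covariantly_constant_def)
    ultimately show ?thesis using g(1) by (simp add: gmul_closed ginv_closed)
  qed
  then show ?thesis using Gau_A_iff[OF P] V(1) by blast
qed

lemma rho_scaleR: "rho g (r *\<^sub>R w) = r *\<^sub>R rho g w"
  by (simp add: rho_def vec_eq_iff matrix_vector_mult_def sum_2 algebra_simps)

lemma stabilizer_conjugate:
  assumes "v \<noteq> 0" and g: "g \<in> phi v \<Phi> p" and k: "k \<in> G"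
  shows "rho k (\<Phi> p) = \<Phi> p \<longleftrightarrow> gmul (ginv g) (gmul k g) \<in> K"
proof -
  define e where "e = (vector [0, complex_of_real v] :: complex ^ 2)"
  obtain \<eta> where \<eta>: "\<eta> > 0" "\<Phi> p = (\<eta> / sqrt 2) *\<^sub>R rho g e" and G: "g \<in> G"
    using g by (auto simp: phi_def e_def)
  have "rho k (\<Phi> p) = \<Phi> p \<longleftrightarrow> rho (gmul k g) e = rho g e"
    using \<eta> by (simp add: rho_scaleR rho_gmul)
  also have "\<dots> \<longleftrightarrow> rho (gmul (ginv g) (gmul k g)) e = e"
    by (metis G gmul_ginv gone_simps(2) rho_gmul)
  also have "\<dots> \<longleftrightarrow> gmul (ginv g) (gmul k g) \<in> K"
    using G k unfolding K_stabilizer[OF assms(1)] e_def by (simp add: gmul_closed ginv_closed)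
  finally show ?thesis .
qed

text \<open>
  Conjugation fixes the \<open>U(1)\<close> component, which determines an element of \<open>K\<close>.  So the conjugate lies
  in \<open>K\<close> only if it equals \<open>k\<close>, that is, if the diagonal matrix of \<open>k\<close> commutes with that of \<open>g\<close>.
\<close>

lemma K_conjugate:
  assumes g: "g \<in> G" and k: "k \<in> K"
  shows "gmul (ginv g) (gmul k g) \<in> K \<longleftrightarrow> fst g $ 2 $ 1 = 0 \<or> Im (snd k) = 0"
proof -
  obtain z where z: "k = (diag2 z (cnj z), z)" "cmod z = 1" using k by (auto simp: K_eq)
  have a: "fst g $ 1 $ 2 = - cnj (fst g $ 2 $ 1)" using SU2_entries(2) g by (auto simp: G_def)
  have "snd (gmul (ginv g) (gmul k g)) = z"
    using gmul_ginv(1)[OF g] by (simp add: gmul_def ginv_def gone_def z(1) mult.left_commute)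
  then have "gmul (ginv g) (gmul k g) \<in> K \<longleftrightarrow> gmul (ginv g) (gmul k g) = k"
    using z k by (auto simp: K_eq)
  also have "\<dots> \<longleftrightarrow> gmul k g = gmul g k" by (metis g gmul_inv_cancel(1,2))
  also have "\<dots> \<longleftrightarrow> fst g $ 2 $ 1 = 0 \<or> z = cnj z"
    using a by (auto simp: z(1) gmul_def diag2_def matrix_matrix_mult_def sum_2 vec_eq_iff forall_2 mult.commute)
  also have "z = cnj z \<longleftrightarrow> Im (snd k) = 0" by (auto simp: z(1) complex_eq_iff)
  finally show ?thesis .
qed

lemma Z2_eq: "Z2 = {gone, - gone}"
  by (auto simp: Z2_def gone_def u1_def cis_pi prod_eq_iff)

lemma K_real: "k \<in> K \<Longrightarrow> Im (snd k) = 0 \<Longrightarrow> k \<in> Z2"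
proof -
  assume "k \<in> K" and i: "Im (snd k) = 0"
  then obtain z where z: "k = (diag2 z (cnj z), z)" "cmod z = 1" by (auto simp: K_eq)
  then have "z = 1 \<or> z = - 1" using i by (auto simp: cmod_def complex_eq_iff power2_eq_1_iff)
  then show ?thesis unfolding Z2_eq using z(1)
    by (auto simp: gone_def diag2_def mat_def vec_eq_iff forall_2)
qed

lemma complex_real_span:
  assumes "Im z \<noteq> 0"
  obtains x y where "\<zeta> = complex_of_real x + complex_of_real y * z"
  by (rule that[of "Re \<zeta> - Im \<zeta> / Im z * Re z" "Im \<zeta> / Im z"])
    (use assms in \<open>simp add: complex_eq_iff\<close>)

lemma diagonal_real_span:
  assumes "Im z \<noteq> 0"
  obtains x y where "diag2 \<alpha> (cnj \<alpha>) = x *\<^sub>R mat 1 + y *\<^sub>R diag2 z (cnj z)"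
proof -
  obtain x y where "\<alpha> = complex_of_real x + complex_of_real y * z"
    using complex_real_span[OF assms] by blast
  then show ?thesis
    by (intro that[of x y]) (simp add: vec_eq_iff forall_2 diag2_def mat_def, simp add: scaleR_conv_of_real)
qed

text \<open>
  For \<open>a = diag(z, cnj z)\<close>, the matrices \<open>b\<close> and \<open>a b\<close> have the lower left entries \<open>\<beta>\<close> and
  \<open>cnj z \<beta>\<close>, which span \<open>\<complex>\<close> over \<open>\<real>\<close>; they adjust the first column of \<open>c\<close> below the
  diagonal, and the span of \<open>1\<close> and \<open>a\<close> then adjusts its diagonal entry.  The second column of a
  quaternion is determined by the first.
\<close>

lemma SU2_real_span:
  assumes z: "Im z \<noteq> 0" and b: "b \<in> SU2" "b $ 2 $ 1 \<noteq> 0" and c: "c \<in> SU2"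
  obtains x y u w where
    "c = x *\<^sub>R mat 1 + y *\<^sub>R diag2 z (cnj z) + u *\<^sub>R b + w *\<^sub>R (diag2 z (cnj z) ** b)"
proof -
  obtain u w where "c $ 2 $ 1 / b $ 2 $ 1 = complex_of_real u + complex_of_real w * cnj z"
    using complex_real_span[of "cnj z"] z by auto
  then have 2: "c $ 2 $ 1 = (complex_of_real u + complex_of_real w * cnj z) * b $ 2 $ 1"
    using b(2) by (simp add: field_simps)
  obtain x y where "c $ 1 $ 1 - (complex_of_real u + complex_of_real w * z) * b $ 1 $ 1
      = complex_of_real x + complex_of_real y * z"
    using complex_real_span[OF z] by blast
  then have 1: "c $ 1 $ 1 = complex_of_real x + complex_of_real y * z
      + (complex_of_real u + complex_of_real w * z) * b $ 1 $ 1"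
    by (simp add: algebra_simps)
  have "c $ 1 $ 1 = x *\<^sub>R 1 + y *\<^sub>R z + u *\<^sub>R b $ 1 $ 1 + w *\<^sub>R (z * b $ 1 $ 1)"
    "c $ 2 $ 2 = x *\<^sub>R 1 + y *\<^sub>R cnj z + u *\<^sub>R b $ 2 $ 2 + w *\<^sub>R (cnj z * b $ 2 $ 2)"
    "c $ 2 $ 1 = u *\<^sub>R b $ 2 $ 1 + w *\<^sub>R (cnj z * b $ 2 $ 1)"
    "c $ 1 $ 2 = u *\<^sub>R b $ 1 $ 2 + w *\<^sub>R (z * b $ 1 $ 2)"
    unfolding SU2_entries(1,2)[OF c] SU2_entries(1,2)[OF b(1)] 1 2
    by (simp_all add: scaleR_conv_of_real algebra_simps)
  then show ?thesis
    by (intro that[of x y u w])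
      (simp add: vec_eq_iff forall_2 diag2_def mat_def matrix_matrix_mult_def sum_2)
qed

text \<open>
  The corresponding combination of fields is covariantly constant.  Its \<open>U(1)\<close> component need
  not be a unit; multiplication by the central idempotent \<open>(1, 0)\<close> removes it, and the central
  element \<open>(0, t)\<close> puts \<open>t\<close> in its place.
\<close>

lemma Gau_A_real_span:
  fixes M :: "('m::{t2_space,second_countable_topology}, 'e::euclidean_space) chart set"
  assumes pb: "principal_bundle M P \<pi> act" and A: "connection_form P act A"
    and conn: "connected (UNIV :: 'm set)"
    and lm: "(a, r) \<in> eval_at p\<^sub>0 (Gau_A P act A)" "(b, s) \<in> eval_at p\<^sub>0 (Gau_A P act A)"
    and c: "x *\<^sub>R mat 1 + y *\<^sub>R a + u *\<^sub>R b + w *\<^sub>R (a ** b) \<in> SU2" "t \<in> U1"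
  shows "(x *\<^sub>R mat 1 + y *\<^sub>R a + u *\<^sub>R b + w *\<^sub>R (a ** b), t) \<in> eval_at p\<^sub>0 (Gau_A P act A)"
proof -
  note P = principal_bundleD(2)[OF pb]
  obtain l m where l: "covariantly_constant P act A l" "l p\<^sub>0 = (a, r)"
    and m: "covariantly_constant P act A m" "m p\<^sub>0 = (b, s)"
    using lm unfolding eval_at_def by (auto simp: Gau_A_iff[OF P])
  define V where "V p = gmul (mat 1, 0)
    (x *\<^sub>R gone + y *\<^sub>R l p + u *\<^sub>R m p + w *\<^sub>R gmul (l p) (m p)) + (0, t)" for p
  have V: "covariantly_constant P act A V"
    unfolding V_def
    by (intro covariantly_constant_add covariantly_constant_gmul covariantly_constant_scaleR
        covariantly_constant_central P l(1) m(1)) (auto simp: gmul_def gone_def)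
  have "V p\<^sub>0 = (x *\<^sub>R mat 1 + y *\<^sub>R a + u *\<^sub>R b + w *\<^sub>R (a ** b), t)"
    by (simp add: V_def l(2) m(2) gmul_def gone_def)
  moreover from this have "V \<in> Gau_A P act A"
    using c by (intro covariantly_constant_in_Gau_A[where p\<^sub>0 = p\<^sub>0, OF pb A conn V]) (auto simp: G_def)
  ultimately show ?thesis unfolding eval_at_def by (metis imageI)
qed

text \<open>
  Combinations of \<open>1\<close> and the given element yield the diagonal torus.  Either nothing else
  occurs, or a non-diagonal element \<open>b\<close> makes the combinations exhaust \<open>SU(2)\<close>.
\<close>

lemma Gau_A_with_noncentral_diagonal:
  fixes M :: "('m::{t2_space,second_countable_topology}, 'e::euclidean_space) chart set"
  assumes pb: "principal_bundle M P \<pi> act" and A: "connection_form P act A"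
    and conn: "connected (UNIV :: 'm set)"
    and z: "(diag2 z (cnj z), r) \<in> eval_at p\<^sub>0 (Gau_A P act A)" "Im z \<noteq> 0"
  shows "eval_at p\<^sub>0 (Gau_A P act A) = SU2 \<times> U1 \<or> eval_at p\<^sub>0 (Gau_A P act A) = U1_U1"
proof -
  define S where "S = eval_at p\<^sub>0 (Gau_A P act A)"
  have S_G: "S \<subseteq> SU2 \<times> U1"
    unfolding S_def eval_at_def G_def[symmetric]
    using Gau_A_iff[OF principal_bundleD(2)[OF pb], of _ act A] by blast
  note span = Gau_A_real_span[OF pb A conn, of _ _ p\<^sub>0, folded S_def]
  note zS = z(1)[folded S_def]
  have diag: "diag2 \<alpha> (cnj \<alpha>) \<in> SU2" if "cmod \<alpha> = 1" for \<alpha>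
    using that K_stabilizer[of 1] by (auto simp: K_eq G_def)
  show ?thesis
  proof (cases "\<forall>k\<in>S. fst k $ 2 $ 1 = 0")
    case True
    have "k \<in> U1_U1" if k: "k \<in> S" for k
    proof -
      have a: "fst k \<in> SU2" "snd k \<in> U1" using S_G k by auto
      have 0: "fst k $ 2 $ 1 = 0" using True k by blast
      have "fst k = diag2 (fst k $ 1 $ 1) (cnj (fst k $ 1 $ 1))"
        using SU2_entries(1,2)[OF a(1)] 0 by (simp add: vec_eq_iff forall_2 diag2_def)
      moreover have "cmod (fst k $ 1 $ 1) = 1"
        using SU2_entries(3)[OF a(1)] 0 by (simp add: cmod_eq_1_iff)
      ultimately show ?thesis using a(2) unfolding U1_U1_def by (cases k) auto
    qed
    moreover have "k \<in> S" if kU: "k \<in> U1_U1" for k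
    proof -
      obtain \<alpha> t where k: "k = (diag2 \<alpha> (cnj \<alpha>), t)" "cmod \<alpha> = 1" "t \<in> U1"
        using kU by (auto simp: U1_U1_def)
      obtain x y where xy: "diag2 \<alpha> (cnj \<alpha>) = x *\<^sub>R mat 1 + y *\<^sub>R diag2 z (cnj z)"
        using diagonal_real_span[OF z(2)] by blast
      show ?thesis
        using span[OF zS zS, of x y 0 0 t] diag[OF k(2)] k by (simp add: xy)
    qed
    ultimately show ?thesis unfolding S_def[symmetric] by blast
  next
    case False
    then obtain b s where b: "(b, s) \<in> S" "b $ 2 $ 1 \<noteq> 0" by auto
    have bS: "b \<in> SU2" using S_G b by auto
    have "(c, t) \<in> S" if "c \<in> SU2" "t \<in> U1" for c t
      using SU2_real_span[OF z(2) bS b(2) that(1)] span[OF zS b(1)] that by metis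
    then show ?thesis using S_G unfolding S_def[symmetric] by auto
  qed
qed

lemma rho_minus_gone: "rho (- gone) w = w"
  by (simp add: rho_def gone_def vec_eq_iff matrix_vector_mult_def mat_def sum_2 forall_2)

lemma minus_gone_in_G: "- gone \<in> G"
proof -
  have "gmul (ginv (- gone)) (- gone) = gone"
    using gmul_ginv(1)[OF gone_in_G]
    by (simp only: linear_neg[OF bounded_linear.linear[OF bounded_linear_ginv]]
        gmul.minus_left gmul.minus_right minus_minus)
  moreover have "det (fst (- gone)) = 1" by (simp add: gone_def det_2 mat_def)
  ultimately show ?thesis by (simp only: G_iff)
qed

lemma Z2_subset_stabilizer:
  assumes P: "smooth_atlas P"
  shows "Z2 \<subseteq> eval_at p\<^sub>0 (Gau_A_section P act A \<Phi>)"
proof -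
  have "(\<lambda>p. k) \<in> Gau_A_section P act A \<Phi>" if "k = gone \<or> k = - gone" for k
  proof -
    have "covariantly_constant P act A (\<lambda>p. k)"
      using that by (intro covariantly_constant_central) (auto simp: gmul.minus_left gmul.minus_right)
    moreover have "k \<in> G" using that gone_in_G minus_gone_in_G by auto
    moreover have "gauge_section (\<lambda>p. k) \<Phi> = \<Phi>"
      using that by (auto simp: gauge_section_def fun_eq_iff gone_simps rho_minus_gone)
    ultimately show ?thesis by (auto simp: Gau_A_section_def Gau_A_iff[OF P])
  qed
  then show ?thesis unfolding Z2_eq eval_at_def by force
qed

lemma gone_in_K: "gone \<in> K"
  using K_eq by (auto simp: gone_def diag2_def mat_def vec_eq_iff intro!: exI[of _ 1])

theorem proposition5p6p11:
  fixes M :: "('m::{t2_space,second_countable_topology}, real ^ 3) chart set"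
    and P :: "('p::{t2_space,second_countable_topology}, 'f::euclidean_space) chart set"
    and \<pi> :: "'p \<Rightarrow> 'm"
    and act :: "'p \<Rightarrow> amb \<Rightarrow> 'p"
    and A :: "'p \<Rightarrow> ('p, 'f) tangent \<Rightarrow> amb"
    and \<Phi> :: "'p \<Rightarrow> complex ^ 2"
    and v :: real
    and p\<^sub>0 :: 'p
  assumes "oriented_atlas M"
    and "compact (UNIV :: 'm set)"
    and "connected (UNIV :: 'm set)"
    and "principal_bundle M P \<pi> act"
    and "connection_form P act A"
    and "equivariant_section P act \<Phi>"
    and "\<forall>p. \<Phi> p \<noteq> 0"
    and "v \<noteq> 0"
    and "phi v \<Phi> p\<^sub>0 = coset_K gone"
  shows "eval_at p\<^sub>0 (Gau_A_section P act A \<Phi>) =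
    (if (\<forall>p \<in> holonomy_bundle P A p\<^sub>0. beta_vanishes v \<Phi> p) \<and>
        (eval_at p\<^sub>0 (Gau_A P act A) = SU2 \<times> U1 \<or> eval_at p\<^sub>0 (Gau_A P act A) = U1_U1)
     then K else Z2)"
proof -
  note conn = assms(3) and pb = assms(4) and A = assms(5) and \<Phi> = assms(6) and v = assms(8)
  note P = principal_bundleD(2)[OF pb]
  define S where "S = eval_at p\<^sub>0 (Gau_A P act A)"
  define H where "H = holonomy_bundle P A p\<^sub>0"
  have K_G: "K \<subseteq> G" using K_stabilizer[OF v] by auto
  have gone_phi: "gone \<in> phi v \<Phi> p\<^sub>0" using assms(9) gone_in_K by (force simp: coset_K_def)
  have const: "l p = l p\<^sub>0" if "l \<in> Gau_A P act A" "p \<in> H" for l p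
    using that covariantly_constant_holonomy_bundle[OF P, of act A l p p\<^sub>0]
    by (simp add: Gau_A_iff[OF P] H_def)
  have in_G: "l p \<in> G" if "l \<in> Gau_A P act A" for l p
    using that by (auto simp: Gau_A_iff[OF P])
  have in_K: "l p\<^sub>0 \<in> K" if l: "l \<in> Gau_A P act A" "gauge_section l \<Phi> = \<Phi>" for l
    using stabilizer_conjugate[OF v gone_phi in_G[OF l(1)]] fun_cong[OF l(2), of p\<^sub>0]
      gmul_inv_cancel(1)[OF gone_in_G] by (simp add: gauge_section_def)
  show ?thesis
  proof (cases "(\<forall>p\<in>H. beta_vanishes v \<Phi> p) \<and> (S = SU2 \<times> U1 \<or> S = U1_U1)")
    case True
    have "eval_at p\<^sub>0 (Gau_A_section P act A \<Phi>) = K"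
    proof
      show "eval_at p\<^sub>0 (Gau_A_section P act A \<Phi>) \<subseteq> K"
        using in_K by (auto simp: eval_at_def Gau_A_section_def)
      show "K \<subseteq> eval_at p\<^sub>0 (Gau_A_section P act A \<Phi>)"
      proof
        fix k assume k: "k \<in> K"
        have "K \<subseteq> U1_U1" by (auto simp: K_eq U1_U1_def U1_iff)
        then have "k \<in> S" using True k K_G by (auto simp: G_def)
        then obtain l where l: "l \<in> Gau_A P act A" "l p\<^sub>0 = k" by (auto simp: S_def eval_at_def)
        have "gauge_section l \<Phi> p = \<Phi> p" for p
        proof -
          obtain q where q: "q \<in> H" "\<pi> p = \<pi> q"
            using holonomy_bundle_covers_base[OF pb A conn, of p\<^sub>0] unfolding H_def by (metis UNIV_I imageE)
          obtain h where h: "h \<in> G" "p = act q h" using fibre_transitive[OF pb q(2)] by blast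
          obtain g where g: "g \<in> G" "phi v \<Phi> q = coset_K g"
            using polar_decomposition(2)[OF v, of \<Phi> q] assms(7) by blast
          have gphi: "g \<in> phi v \<Phi> q" using g(2) gone_in_K by (force simp: coset_K_def)
          have "fst g $ 2 $ 1 = 0" using True q(1) gphi by (auto simp: beta_vanishes_def)
          then have "rho k (\<Phi> q) = \<Phi> q"
            using stabilizer_conjugate[OF v gphi, of k] K_conjugate[OF g(1) k] k K_G by blast
          then have "rho (l q) (\<Phi> q) = \<Phi> q" using const[OF l(1) q(1)] l(2) by simp
          moreover have "l p = gmul (gmul (ginv h) (l q)) h"
            using l(1) h unfolding Gau_A_iff[OF P] covariantly_constant_def by blast
          moreover have "\<Phi> p = rho (ginv h) (\<Phi> q)"
            using \<Phi> h unfolding equivariant_section_def by blast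
          ultimately show ?thesis
            unfolding gauge_section_def
            by (metis h(1) gmul_inv_cancel(3) rho_gmul)
        qed
        then have "l \<in> Gau_A_section P act A \<Phi>" using l(1) by (auto simp: Gau_A_section_def)
        then show "k \<in> eval_at p\<^sub>0 (Gau_A_section P act A \<Phi>)" using l(2) by (auto simp: eval_at_def)
      qed
    qed
    then show ?thesis using True unfolding S_def H_def by simp
  next
    case False
    have "l p\<^sub>0 \<in> Z2" if l: "l \<in> Gau_A P act A" "gauge_section l \<Phi> = \<Phi>" for l
    proof (rule ccontr)
      assume "l p\<^sub>0 \<notin> Z2"
      then have im: "Im (snd (l p\<^sub>0)) \<noteq> 0" using K_real[OF in_K[OF l]] by blast
      have "beta_vanishes v \<Phi> p" if p: "p \<in> H" for p
        unfolding beta_vanishes_def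
      proof
        fix g assume g: "g \<in> phi v \<Phi> p"
        then have gG: "g \<in> G" by (simp add: phi_def)
        have "rho (l p) (\<Phi> p) = \<Phi> p" using fun_cong[OF l(2), of p] by (simp add: gauge_section_def)
        then have "gmul (ginv g) (gmul (l p\<^sub>0) g) \<in> K"
          using stabilizer_conjugate[OF v g in_G[OF l(1)]] const[OF l(1) p] by simp
        then show "fst g $ 2 $ 1 = 0" using K_conjugate[OF gG in_K[OF l]] im by blast
      qed
      moreover have "S = SU2 \<times> U1 \<or> S = U1_U1"
      proof -
        obtain z where z: "l p\<^sub>0 = (diag2 z (cnj z), z)" using in_K[OF l] by (auto simp: K_eq)
        then have "(diag2 z (cnj z), z) \<in> S" using l(1) unfolding S_def eval_at_def by (metis imageI)
        then show ?thesis
          using Gau_A_with_noncentral_diagonal[OF pb A conn, of z z p\<^sub>0] im z by (simp add: S_def)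
      qed
      ultimately show False using False by blast
    qed
    then have "eval_at p\<^sub>0 (Gau_A_section P act A \<Phi>) = Z2"
      using Z2_subset_stabilizer[OF P, of p\<^sub>0 act A \<Phi>] by (auto simp: eval_at_def Gau_A_section_def)
    then show ?thesis using False unfolding S_def H_def by auto
  qed
qed

end
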